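(* Let $H$ and $U$ be real Hilbert spaces, let $A:D(A)\subset H\to H$ be a densely defined linear operator generating a strongly continuous semigroup of contractions on $H$, let $B\in\mathcal L(U,H)$ with adjoint $B^\star$, and let $k>0$. Assume that the origin of the linear system $\frac{d}{dt}z=(A-kBB^\star)z$ is globally polynomially stable with $\theta=1$ and some rate $\gamma_0>\frac12$, i.e. there exist $C_0>0$ and $\gamma_0>\frac12$ such that $$\|e^{t(A-kBB^\star)}z_0\|_H\le\frac{C_0}{(1+t)^{\gamma_0}}\|z_0\|_{D(A-kBB^\star)},\qquad\forall z_0\in D(A-kBB^\star)=D(A),\ \forall t\ge0.$$ Let $\sigma:U\to U$ be a nonlinear damping function (with $S=U$), i.e. a function satisfying all the properties (D1), (D2), (D3) given in the context. Then the origin of $$\frac{d}{dt}z=A_\sigma(z):=Az-\sqrt{k}\,B\sigma(\sqrt{k}\,B^\star z),\qquad z(0)=z_0,\qquad D(A_\sigma)=D(A),$$ is semi-globally polynomially stable in $D(A)$ with $\gamma=\frac12$: for every $r>0$ there exists a positive constant $C=C(r)$ such that, for every $z_0\in D(A)$ with $\|z_0\|_{D(A)}\le r$, $$\|W_\sigma(t)z_0\|_H\le\frac{C}{(1+t)^{1/2}}\|z_0\|_{D(A)},\qquad\forall t\ge0.$$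
   Context: For an operator $L$ on $H$, $\|z\|_{D(L)}=\|z\|_H+\|Lz\|_H$ is the graph norm. Properties of $\sigma:U\to U$: (D1) $\sigma$ is locally Lipschitz. (D2) $\langle\sigma(s_1)-\sigma(s_2),s_1-s_2\rangle_U\ge 0$ for all $s_1,s_2\in U$. (D3) There exist positive constants $C_1,C_2$ and a continuous non-decreasing function $h:\mathbb R\to\mathbb R_+$ with $h(0)>0$ such that $$\|\sigma(s)-C_1s\|_{U}\le C_2\,h(\|s\|_U)\,\langle\sigma(s),s\rangle_U\qquad\forall s\in U.$$ A strong solution of the nonlinear system is a locally absolutely continuous function $z:[0,\infty)\to H$ with $z(0)=z_0$, $z(t)\in D(A)$ for all $t\ge 0$, satisfying the equation for almost every $t\ge0$. Under (D1)–(D3) it is known that for every $z_0\in D(A)$ there is a unique strong solution, denoted $W_\sigma(t)z_0$, and that $t\mapsto\|W_\sigma(t)z_0\|_H$ and $t\mapsto\|A_\sigma W_\sigma(t)z_0\|_H$ are nonincreasing.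
   Formalization: "Locally Lipschitz" in (D1) is taken as Lipschitz on every bounded subset of U (the same thing if U is finite-dimensional); if it only means Lipschitz near each point, the claim fails for infinite-dimensional U, since σ may be unbounded on bounded sets. *)

theory Defs
  imports "HOL-Analysis.Analysis"
begin

text \<open>
  An unbounded operator is given by its domain \<open>D\<close> together with a total function, whose values
  outside \<open>D\<close> are irrelevant. Semigroups are functions of a real time parameter of which only the
  values at nonnegative times matter.
\<close>

definition densely_defined_linear ::
  "'h::real_normed_vector set \<Rightarrow> ('h \<Rightarrow> 'h) \<Rightarrow> bool" where
  "densely_defined_linear D A \<longleftrightarrow>
     subspace D \<and> closure D = UNIV \<and>
     (\<forall>x\<in>D. \<forall>y\<in>D. A (x + y) = A x + A y) \<and>
     (\<forall>c. \<forall>x\<in>D. A (c *\<^sub>R x) = c *\<^sub>R A x)"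

definition C0_semigroup :: "(real \<Rightarrow> 'h::real_normed_vector \<Rightarrow> 'h) \<Rightarrow> bool" where
  "C0_semigroup T \<longleftrightarrow>
     (\<forall>t\<ge>0. bounded_linear (T t)) \<and>
     (\<forall>z. T 0 z = z) \<and>
     (\<forall>s\<ge>0. \<forall>t\<ge>0. \<forall>z. T (s + t) z = T s (T t z)) \<and>
     (\<forall>z. ((\<lambda>t. T t z) \<longlongrightarrow> z) (at_right 0))"

definition generates_C0_semigroup ::
  "'h::real_normed_vector set \<Rightarrow> ('h \<Rightarrow> 'h) \<Rightarrow> (real \<Rightarrow> 'h \<Rightarrow> 'h) \<Rightarrow> bool" where
  "generates_C0_semigroup D A T \<longleftrightarrow>
     C0_semigroup T \<and>
     D = {z. \<exists>y. ((\<lambda>t. (T t z - z) /\<^sub>R t) \<longlongrightarrow> y) (at_right 0)} \<and>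
     (\<forall>z\<in>D. ((\<lambda>t. (T t z - z) /\<^sub>R t) \<longlongrightarrow> A z) (at_right 0))"

definition generates_contraction_semigroup ::
  "'h::real_normed_vector set \<Rightarrow> ('h \<Rightarrow> 'h) \<Rightarrow> bool" where
  "generates_contraction_semigroup D A \<longleftrightarrow>
     (\<exists>T. generates_C0_semigroup D A T \<and> (\<forall>t\<ge>0. \<forall>z. norm (T t z) \<le> norm z))"

definition graph_norm :: "('h::real_normed_vector \<Rightarrow> 'h) \<Rightarrow> 'h \<Rightarrow> real" where
  "graph_norm L z = norm z + norm (L z)"

text \<open>
  ``Locally Lipschitz'' is Lipschitz continuity on bounded sets, as is usual for semilinear
  evolution equations. In an infinite-dimensional space this is stronger than Lipschitz
  continuity near each point, which would allow \<open>\<sigma>\<close> to be unbounded on bounded sets.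
\<close>

definition lipschitz_on_bounded_sets :: "('u::real_normed_vector \<Rightarrow> 'u) \<Rightarrow> bool" where
  "lipschitz_on_bounded_sets \<sigma> \<longleftrightarrow> (\<forall>R. \<exists>L. L-lipschitz_on (cball 0 R) \<sigma>)"

definition damping_function :: "('u::real_inner \<Rightarrow> 'u) \<Rightarrow> bool" where
  "damping_function \<sigma> \<longleftrightarrow>
     lipschitz_on_bounded_sets \<sigma> \<and>
     (\<forall>s1 s2. (\<sigma> s1 - \<sigma> s2) \<bullet> (s1 - s2) \<ge> 0) \<and>
     (\<exists>C1>0. \<exists>C2>0. \<exists>h::real \<Rightarrow> real.
        continuous_on UNIV h \<and> mono h \<and> (\<forall>x. h x \<ge> 0) \<and> h 0 > 0 \<and>
        (\<forall>s. norm (\<sigma> s - C1 *\<^sub>R s) \<le> C2 * h (norm s) * (\<sigma> s \<bullet> s)))"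

text \<open>
  The finite set \<open>I\<close> below ranges over families of pairwise non-overlapping subintervals,
  each represented by the pair of its endpoints.
\<close>

definition absolutely_continuous_on_interval ::
  "real \<Rightarrow> real \<Rightarrow> (real \<Rightarrow> 'a::metric_space) \<Rightarrow> bool" where
  "absolutely_continuous_on_interval a b f \<longleftrightarrow>
     (\<forall>\<epsilon>>0. \<exists>\<delta>>0. \<forall>I::(real \<times> real) set.
        finite I \<longrightarrow>
        (\<forall>(x, y)\<in>I. a \<le> x \<and> x \<le> y \<and> y \<le> b) \<longrightarrow>
        pairwise (\<lambda>(x, y) (x', y'). {x<..<y} \<inter> {x'<..<y'} = {}) I \<longrightarrow>
        (\<Sum>(x, y)\<in>I. y - x) < \<delta> \<longrightarrow>
        (\<Sum>(x, y)\<in>I. dist (f x) (f y)) < \<epsilon>)"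

definition strong_solution ::
  "'h::real_normed_vector set \<Rightarrow> ('h \<Rightarrow> 'h) \<Rightarrow> 'h \<Rightarrow> (real \<Rightarrow> 'h) \<Rightarrow> bool" where
  "strong_solution D F z0 z \<longleftrightarrow>
     (\<forall>b\<ge>0. absolutely_continuous_on_interval 0 b z) \<and>
     z 0 = z0 \<and>
     (\<forall>t\<ge>0. z t \<in> D) \<and>
     (AE t in lborel. t \<ge> 0 \<longrightarrow> (z has_vector_derivative F (z t)) (at t within {0..}))"

definition linear_closed_loop ::
  "('h::real_inner \<Rightarrow> 'h) \<Rightarrow> ('u::real_inner \<Rightarrow> 'h) \<Rightarrow> real \<Rightarrow> 'h \<Rightarrow> 'h" where
  "linear_closed_loop A B k z = A z - k *\<^sub>R B (adjoint B z)"

definition nonlinear_closed_loop ::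
  "('h::real_inner \<Rightarrow> 'h) \<Rightarrow> ('u::real_inner \<Rightarrow> 'h) \<Rightarrow> real \<Rightarrow> ('u \<Rightarrow> 'u) \<Rightarrow> 'h \<Rightarrow> 'h" where
  "nonlinear_closed_loop A B k \<sigma> z = A z - sqrt k *\<^sub>R B (\<sigma> (sqrt k *\<^sub>R adjoint B z))"

end

theory Submission
  imports Defs
begin

text \<open>
  Write \<open>L = A - kBB\<^sup>*\<close>, let \<open>F\<close> be the nonlinear operator, and let \<open>s = \<surd>k B\<^sup>*z\<close> along a
  solution \<open>z\<close> of the nonlinear system. On
  bounded sets the mismatch \<open>|s - \<sigma>(s)|\<^sup>2\<close> is at most a multiple of \<open>\<langle>\<sigma>(s), s\<rangle>\<close>, the dissipation
  rate of the energy, and \<open>L\<close> dissipates \<open>|\<surd>k B\<^sup>*y|\<^sup>2\<close>; hence on any time window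
  \<open>|z(t+\<tau>) - e\<^bsup>\<tau>L\<^esup>z(t)|\<^sup>2 \<le> c (|z(t)|\<^sup>2 - |z(t+\<tau>)|\<^sup>2)\<close>. Since \<open>F\<close> is dissipative, the graph norm of
  \<open>z(t)\<close> stays bounded by a multiple of that of \<open>z\<^sub>0\<close>, so the linear decay gives
  \<open>E(t+\<tau>) \<le> q E(t) + K/(1+\<tau>)\<close> for \<open>E = |z|\<^sup>2\<close>, with \<open>q < 1\<close>. Choosing \<open>\<tau>\<close> proportional to the
  final time turns this into \<open>E(t) = O(1/t)\<close>.
\<close>

section \<open>Riesz representation and adjoints\<close>

text \<open>The constant \<open>c\<close> in the comparison with the linear orbit does not depend on
  the window length. That permits windows comparable with the elapsed time at a fixed contraction
  factor \<open>q\<close>; the exponent 1/2 enters because its square gives the summand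
  \<open>K / (1 + \<tau>)\<close>.

  The equation holds only at almost every time, for functions with values in a Hilbert space. The
  estimates along solutions use no variation-of-constants formula: each says that a real absolutely
  continuous function with nonpositive derivative almost everywhere does not grow. The graph norm
  along a solution is reached through its speed, by comparing the solution with its own time shifts.
  This costs a factor 2 and is available only off a null set, which restart times must avoid.

  The semigroup \<open>S\<close> is not assumed contractive. The decay estimate makes its orbits
  from \<open>D\<close> continuous, dissipativity of \<open>L\<close> makes it contract on
  \<open>D\<close>, and density of \<open>D\<close> does the rest.

  The radius \<open>r\<close> only selects the ball on which the damping is controlled. All later
  bounds are homogeneous in the initial graph norm, so the final one is linear in it.\<close>

lemma riesz_representation:
  fixes \<phi> :: "'a::{real_inner,complete_space} \<Rightarrow> real"
  assumes "bounded_linear \<phi>"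
  shows "\<exists>v. \<forall>x. \<phi> x = x \<bullet> v"
proof -
  interpret \<phi>: bounded_linear \<phi> by fact
  obtain K where K: "\<And>x. norm (\<phi> x) \<le> norm x * K"
    using \<phi>.bounded by blast
  \<comment> \<open>For the sought \<open>v\<close>, \<open>J x\<close> is |x - v|^2 - |v|^2, so
    \<open>v\<close> can be found as the minimiser of an expression that does not mention
    it.\<close>
  define J where "J x = x \<bullet> x - 2 * \<phi> x" for x
  have J_lower: "J x \<ge> - K\<^sup>2" for x
  proof -
    have "\<phi> x \<le> norm x * K" using K[of x] by simp
    then have "J x + K\<^sup>2 \<ge> (norm x - K)\<^sup>2"
      unfolding J_def by (simp add: power2_diff power2_norm_eq_inner)
    then show ?thesis by (smt (verit) zero_le_power2)
  qed
  have bdd: "bdd_below (range J)"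
    using J_lower by (auto intro!: bdd_belowI)
  define m where "m = Inf (range J)"
  have m_le: "m \<le> J x" for x
    unfolding m_def using bdd by (intro cInf_lower) auto
  have "\<exists>x. J x < m + 1 / real (Suc n)" for n
  proof -
    have "\<exists>y\<in>range J. y < m + 1 / real (Suc n)"
      using cInf_lessD[of "range J" "m + 1 / real (Suc n)"] unfolding m_def by auto
    then show ?thesis by auto
  qed
  then obtain X where X: "\<And>n. J (X n) < m + 1 / real (Suc n)" by metis
  \<comment> \<open>Midpoints have \<open>J\<close> at least \<open>m\<close>, so two nearly minimal
    points are close; the minimising sequence is therefore Cauchy.\<close>
  have parallelogram: "(norm (x - y))\<^sup>2 = 2 * J x + 2 * J y - 4 * J ((1/2) *\<^sub>R (x + y))" for x y
    unfolding J_def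
    by (simp add: power2_norm_eq_inner \<phi>.scaleR \<phi>.add inner_diff inner_add inner_commute algebra_simps)
  have "Cauchy X"
  proof (rule metric_CauchyI)
    fix e :: real assume "e > 0"
    obtain N where N: "1 / real (Suc N) < e\<^sup>2 / 4"
      using \<open>e > 0\<close> nat_approx_posE[of "e\<^sup>2/4"] by auto
    show "\<exists>M. \<forall>i\<ge>M. \<forall>j\<ge>M. dist (X i) (X j) < e"
    proof (intro exI allI impI)
      fix i j assume "i \<ge> N" "j \<ge> N"
      then have "1 / real (Suc i) \<le> 1 / real (Suc N)" "1 / real (Suc j) \<le> 1 / real (Suc N)"
        by (auto simp: frac_le)
      moreover have "(norm (X i - X j))\<^sup>2 \<le> 2 * (1 / real (Suc i)) + 2 * (1 / real (Suc j))"
        unfolding parallelogram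
        using X[of i] X[of j] m_le[of "(1/2) *\<^sub>R (X i + X j)"] by argo
      ultimately have "(norm (X i - X j))\<^sup>2 < e\<^sup>2" using N by argo
      then show "dist (X i) (X j) < e"
        using \<open>e > 0\<close> by (simp add: dist_norm power2_less_imp_less)
    qed
  qed
  then obtain v where v: "X \<longlonglongrightarrow> v"
    using Cauchy_convergent convergent_def by blast
  have "(\<lambda>n. J (X n)) \<longlonglongrightarrow> J v"
    unfolding J_def using v by (intro tendsto_intros \<phi>.tendsto)
  moreover have "(\<lambda>n. m + 1 / real (Suc n)) \<longlonglongrightarrow> m + 0"
    by (intro tendsto_intros LIMSEQ_Suc lim_1_over_n)
  ultimately have "J v \<le> m"
    using LIMSEQ_le[of "\<lambda>n. J (X n)" "J v" "\<lambda>n. m + 1 / real (Suc n)" m] X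
    by (metis add.right_neutral less_imp_le)
  then have J_min: "J v \<le> J x" for x
    using m_le[of x] by simp
  show ?thesis
  proof (intro exI[of _ v] allI)
    fix x
    show "\<phi> x = x \<bullet> v"
    proof (cases "x = 0")
      case False
      \<comment> \<open>\<open>2 * d\<close> is the derivative of \<open>J\<close> at
        \<open>v\<close> along \<open>x\<close>, and \<open>t\<close> minimises the resulting
        quadratic on that line; minimality of \<open>v\<close> forces \<open>d = 0\<close>.\<close>
      define d where "d = v \<bullet> x - \<phi> x"
      define t where "t = - d / (x \<bullet> x)"
      have "J v \<le> J (v + t *\<^sub>R x)" by (rule J_min)
      also have "\<dots> = J v + 2 * t * d + t\<^sup>2 * (x \<bullet> x)"
        unfolding J_def d_def
        by (simp add: \<phi>.add \<phi>.scaleR inner_add inner_commute power2_eq_square algebra_simps)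
      finally have "0 \<le> 2 * t * d + t\<^sup>2 * (x \<bullet> x)" by simp
      also have "\<dots> = - (d\<^sup>2 / (x \<bullet> x))"
        using False unfolding t_def by (simp add: field_simps power2_eq_square)
      finally have "d\<^sup>2 \<le> 0"
        using False inner_gt_zero_iff[of x] by (simp add: divide_le_0_iff not_le[symmetric])
      then show ?thesis by (simp add: d_def inner_commute)
    qed simp
  qed
qed

text \<open>\<open>adjoint\<close> is defined by Hilbert choice, so its defining identity holds only
  once some adjoint is known to exist; the Riesz vectors of the functionals x -> f x . y provide
  one.\<close>

lemma adjoint_inner_right:
  fixes f :: "'a::{real_inner,complete_space} \<Rightarrow> 'b::real_inner"
  assumes "bounded_linear f"
  shows "x \<bullet> adjoint f y = f x \<bullet> y"
proof -
  have "\<exists>v. \<forall>x. f x \<bullet> y = x \<bullet> v" for y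
    using riesz_representation[OF bounded_linear_compose[OF bounded_linear_inner_left assms]]
    by simp
  then have "\<exists>f'. \<forall>x y. f x \<bullet> y = x \<bullet> f' y" by metis
  then have "\<forall>x y. f x \<bullet> y = x \<bullet> adjoint f y"
    unfolding adjoint_def by (rule someI_ex)
  then show ?thesis by simp
qed

text \<open>Linearity holds because a vector is determined by its inner products. For the bound, the
  adjoint identity is tested with \<open>adjoint f x\<close> itself and one factor is
  cancelled.\<close>

lemma bounded_linear_adjoint:
  fixes f :: "'a::{real_inner,complete_space} \<Rightarrow> 'b::real_inner"
  assumes "bounded_linear f"
  shows "bounded_linear (adjoint f)"
proof -
  obtain K where "K \<ge> 0" and K: "\<And>x. norm (f x) \<le> norm x * K"
    using bounded_linear.nonneg_bounded[OF assms] by blast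
  note adj = adjoint_inner_right[OF assms]
  show ?thesis
  proof (rule bounded_linear_intro)
    show "adjoint f (x + y) = adjoint f x + adjoint f y" for x y
      using vector_eq_ldot by (metis adj inner_add_right)
    show "adjoint f (r *\<^sub>R x) = r *\<^sub>R adjoint f x" for r x
      using vector_eq_ldot by (metis adj inner_scaleR_right)
    show "norm (adjoint f x) \<le> norm x * K" for x
    proof (cases "adjoint f x = 0")
      case True
      then show ?thesis using \<open>K \<ge> 0\<close> by simp
    next
      case False
      have "(norm (adjoint f x))\<^sup>2 = f (adjoint f x) \<bullet> x"
        by (simp add: power2_norm_eq_inner adj)
      also have "\<dots> \<le> norm (adjoint f x) * K * norm x"
        using norm_cauchy_schwarz[of "f (adjoint f x)" x] K[of "adjoint f x"]
        by (meson mult_right_mono norm_ge_zero order_trans)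
      finally show ?thesis using False by (simp add: power2_eq_square mult_ac)
    qed
  qed
qed

section \<open>Absolutely continuous functions\<close>

lemma absolutely_continuous_on_intervalD:
  assumes "absolutely_continuous_on_interval a b f" "\<epsilon> > 0"
  obtains \<delta> where "\<delta> > 0"
    "\<And>I. \<lbrakk>finite I; \<And>x y. (x, y) \<in> I \<Longrightarrow> a \<le> x \<and> x \<le> y \<and> y \<le> b;
       pairwise (\<lambda>(x, y) (x', y'). {x<..<y} \<inter> {x'<..<y'} = {}) I;
       (\<Sum>(x, y)\<in>I. y - x) < \<delta>\<rbrakk> \<Longrightarrow> (\<Sum>(x, y)\<in>I. dist (f x) (f y)) < \<epsilon>"
proof -
  from assms(1)[unfolded absolutely_continuous_on_interval_def, THEN spec, THEN mp, OF assms(2)]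
  obtain \<delta> where \<delta>: "\<delta> > 0 \<and> (\<forall>I::(real \<times> real) set. finite I \<longrightarrow>
        (\<forall>(x, y)\<in>I. a \<le> x \<and> x \<le> y \<and> y \<le> b) \<longrightarrow>
        pairwise (\<lambda>(x, y) (x', y'). {x<..<y} \<inter> {x'<..<y'} = {}) I \<longrightarrow>
        (\<Sum>(x, y)\<in>I. y - x) < \<delta> \<longrightarrow> (\<Sum>(x, y)\<in>I. dist (f x) (f y)) < \<epsilon>)"
    by (rule exE)
  show thesis
  proof (rule that[OF conjunct1[OF \<delta>]])
    fix I :: "(real \<times> real) set"
    assume I: "finite I" "\<And>x y. (x, y) \<in> I \<Longrightarrow> a \<le> x \<and> x \<le> y \<and> y \<le> b"
      "pairwise (\<lambda>(x, y) (x', y'). {x<..<y} \<inter> {x'<..<y'} = {}) I" "(\<Sum>(x, y)\<in>I. y - x) < \<delta>"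
    have "\<forall>(x, y)\<in>I. a \<le> x \<and> x \<le> y \<and> y \<le> b" using I(2) by blast
    then show "(\<Sum>(x, y)\<in>I. dist (f x) (f y)) < \<epsilon>"
      using conjunct2[OF \<delta>, THEN spec, THEN mp, THEN mp, THEN mp, THEN mp, OF I(1) _ I(3,4)] by simp
  qed
qed

text \<open>Common source of the closure properties: linear combinations use two functions, squared
  norms use one function twice, and Lipschitz functions use the identity twice.\<close>

lemma absolutely_continuous_on_interval_comparison:
  fixes f :: "real \<Rightarrow> 'a::metric_space" and g :: "real \<Rightarrow> 'b::metric_space"
    and h :: "real \<Rightarrow> 'c::metric_space"
  assumes f: "absolutely_continuous_on_interval a b f"
    and g: "absolutely_continuous_on_interval a b g"
    and le: "\<And>x y. x \<in> {a..b} \<Longrightarrow> y \<in> {a..b} \<Longrightarrow>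
      dist (h x) (h y) \<le> K * (dist (f x) (f y) + dist (g x) (g y))"
  shows "absolutely_continuous_on_interval a b h"
  unfolding absolutely_continuous_on_interval_def
proof (intro allI impI)
  fix \<epsilon> :: real assume "\<epsilon> > 0"
  \<comment> \<open>\<open>K\<close> may have any sign; a positive majorant is needed as a
    divisor.\<close>
  define c where "c = \<bar>K\<bar> + 1"
  have "c > 0" "K \<le> c" unfolding c_def by auto
  define e where "e = \<epsilon> / (2 * c)"
  have "e > 0" unfolding e_def using \<open>\<epsilon> > 0\<close> \<open>c > 0\<close> by simp
  obtain d1 where d1: "d1 > 0"
    "\<And>I. \<lbrakk>finite I; \<And>x y. (x, y) \<in> I \<Longrightarrow> a \<le> x \<and> x \<le> y \<and> y \<le> b;
       pairwise (\<lambda>(x, y) (x', y'). {x<..<y} \<inter> {x'<..<y'} = {}) I;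
       (\<Sum>(x, y)\<in>I. y - x) < d1\<rbrakk> \<Longrightarrow> (\<Sum>(x, y)\<in>I. dist (f x) (f y)) < e"
    using absolutely_continuous_on_intervalD[OF f \<open>e > 0\<close>] by metis
  obtain d2 where d2: "d2 > 0"
    "\<And>I. \<lbrakk>finite I; \<And>x y. (x, y) \<in> I \<Longrightarrow> a \<le> x \<and> x \<le> y \<and> y \<le> b;
       pairwise (\<lambda>(x, y) (x', y'). {x<..<y} \<inter> {x'<..<y'} = {}) I;
       (\<Sum>(x, y)\<in>I. y - x) < d2\<rbrakk> \<Longrightarrow> (\<Sum>(x, y)\<in>I. dist (g x) (g y)) < e"
    using absolutely_continuous_on_intervalD[OF g \<open>e > 0\<close>] by metis
  show "\<exists>\<delta>>0. \<forall>I::(real \<times> real) set. finite I \<longrightarrow>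
        (\<forall>(x, y)\<in>I. a \<le> x \<and> x \<le> y \<and> y \<le> b) \<longrightarrow>
        pairwise (\<lambda>(x, y) (x', y'). {x<..<y} \<inter> {x'<..<y'} = {}) I \<longrightarrow>
        (\<Sum>(x, y)\<in>I. y - x) < \<delta> \<longrightarrow> (\<Sum>(x, y)\<in>I. dist (h x) (h y)) < \<epsilon>"
  proof (intro exI[of _ "min d1 d2"] conjI allI impI)
    fix I :: "(real \<times> real) set"
    assume I: "finite I" "\<forall>(x, y)\<in>I. a \<le> x \<and> x \<le> y \<and> y \<le> b"
      "pairwise (\<lambda>(x, y) (x', y'). {x<..<y} \<inter> {x'<..<y'} = {}) I"
      "(\<Sum>(x, y)\<in>I. y - x) < min d1 d2"
    have sums: "(\<Sum>(x, y)\<in>I. dist (f x) (f y)) < e" "(\<Sum>(x, y)\<in>I. dist (g x) (g y)) < e"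
      using I by (auto intro!: d1(2) d2(2))
    have "(\<Sum>(x, y)\<in>I. dist (h x) (h y))
        \<le> (\<Sum>(x, y)\<in>I. c * (dist (f x) (f y) + dist (g x) (g y)))"
    proof (intro sum_mono, clarify)
      fix x y assume "(x, y) \<in> I"
      then have "dist (h x) (h y) \<le> K * (dist (f x) (f y) + dist (g x) (g y))"
        using I(2) by (intro le) auto
      also have "\<dots> \<le> c * (dist (f x) (f y) + dist (g x) (g y))"
        using \<open>K \<le> c\<close> by (intro mult_right_mono) auto
      finally show "dist (h x) (h y) \<le> c * (dist (f x) (f y) + dist (g x) (g y))" .
    qed
    also have "\<dots> = c * ((\<Sum>(x, y)\<in>I. dist (f x) (f y)) + (\<Sum>(x, y)\<in>I. dist (g x) (g y)))"
      by (simp only: sum_distrib_left[symmetric] sum.distrib[symmetric] case_prod_unfold)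
    also have "\<dots> < c * (e + e)"
      using sums \<open>c > 0\<close> by (intro mult_strict_left_mono) auto
    also have "\<dots> = \<epsilon>"
      using \<open>c > 0\<close> by (simp add: e_def)
    finally show "(\<Sum>(x, y)\<in>I. dist (h x) (h y)) < \<epsilon>" .
  qed (use d1 d2 in auto)
qed

lemma absolutely_continuous_on_subinterval:
  assumes f: "absolutely_continuous_on_interval a b f" and "a \<le> a'" "b' \<le> b"
  shows "absolutely_continuous_on_interval a' b' f"
  unfolding absolutely_continuous_on_interval_def
proof (intro allI impI)
  fix \<epsilon> :: real assume "\<epsilon> > 0"
  obtain d where d: "d > 0"
    "\<And>I. \<lbrakk>finite I; \<And>x y. (x, y) \<in> I \<Longrightarrow> a \<le> x \<and> x \<le> y \<and> y \<le> b;
       pairwise (\<lambda>(x, y) (x', y'). {x<..<y} \<inter> {x'<..<y'} = {}) I;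
       (\<Sum>(x, y)\<in>I. y - x) < d\<rbrakk> \<Longrightarrow> (\<Sum>(x, y)\<in>I. dist (f x) (f y)) < \<epsilon>"
    using absolutely_continuous_on_intervalD[OF f \<open>\<epsilon> > 0\<close>] by metis
  show "\<exists>\<delta>>0. \<forall>I::(real \<times> real) set. finite I \<longrightarrow>
        (\<forall>(x, y)\<in>I. a' \<le> x \<and> x \<le> y \<and> y \<le> b') \<longrightarrow>
        pairwise (\<lambda>(x, y) (x', y'). {x<..<y} \<inter> {x'<..<y'} = {}) I \<longrightarrow>
        (\<Sum>(x, y)\<in>I. y - x) < \<delta> \<longrightarrow> (\<Sum>(x, y)\<in>I. dist (f x) (f y)) < \<epsilon>"
  proof (intro exI[of _ d] conjI allI impI \<open>d > 0\<close>)
    fix I :: "(real \<times> real) set"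
    assume I: "finite I" "\<forall>(x, y)\<in>I. a' \<le> x \<and> x \<le> y \<and> y \<le> b'"
      "pairwise (\<lambda>(x, y) (x', y'). {x<..<y} \<inter> {x'<..<y'} = {}) I"
      "(\<Sum>(x, y)\<in>I. y - x) < d"
    have "a \<le> x \<and> x \<le> y \<and> y \<le> b" if "(x, y) \<in> I" for x y
      using bspec[OF I(2) that] assms(2,3) by simp
    then show "(\<Sum>(x, y)\<in>I. dist (f x) (f y)) < \<epsilon>"
      by (rule d(2)[OF I(1) _ I(3,4)])
  qed
qed

lemma absolutely_continuous_on_interval_ident:
  "absolutely_continuous_on_interval a b (\<lambda>x. x)"
  unfolding absolutely_continuous_on_interval_def
proof (intro allI impI)
  fix \<epsilon> :: real assume "\<epsilon> > 0"
  show "\<exists>\<delta>>0. \<forall>I::(real \<times> real) set. finite I \<longrightarrow>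
        (\<forall>(x, y)\<in>I. a \<le> x \<and> x \<le> y \<and> y \<le> b) \<longrightarrow>
        pairwise (\<lambda>(x, y) (x', y'). {x<..<y} \<inter> {x'<..<y'} = {}) I \<longrightarrow>
        (\<Sum>(x, y)\<in>I. y - x) < \<delta> \<longrightarrow> (\<Sum>(x, y)\<in>I. dist x y) < \<epsilon>"
  proof (intro exI[of _ \<epsilon>] conjI allI impI \<open>\<epsilon> > 0\<close>)
    fix I :: "(real \<times> real) set"
    assume I: "\<forall>(x, y)\<in>I. a \<le> x \<and> x \<le> y \<and> y \<le> b" "(\<Sum>(x, y)\<in>I. y - x) < \<epsilon>"
    have "(\<Sum>(x, y)\<in>I. dist x y) = (\<Sum>(x, y)\<in>I. y - x)"
      using I(1) by (intro sum.cong) (auto simp: dist_real_def)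
    then show "(\<Sum>(x, y)\<in>I. dist x y) < \<epsilon>" using I(2) by simp
  qed
qed

lemma absolutely_continuous_on_interval_shift:
  fixes f :: "real \<Rightarrow> 'a::metric_space"
  assumes f: "absolutely_continuous_on_interval (a + c) (b + c) f"
  shows "absolutely_continuous_on_interval a b (\<lambda>x. f (c + x))"
  unfolding absolutely_continuous_on_interval_def
proof (intro allI impI)
  fix \<epsilon> :: real assume "\<epsilon> > 0"
  obtain d where d: "d > 0"
    "\<And>I. \<lbrakk>finite I; \<And>x y. (x, y) \<in> I \<Longrightarrow> a + c \<le> x \<and> x \<le> y \<and> y \<le> b + c;
       pairwise (\<lambda>(x, y) (x', y'). {x<..<y} \<inter> {x'<..<y'} = {}) I;
       (\<Sum>(x, y)\<in>I. y - x) < d\<rbrakk> \<Longrightarrow> (\<Sum>(x, y)\<in>I. dist (f x) (f y)) < \<epsilon>"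
    using absolutely_continuous_on_intervalD[OF f \<open>\<epsilon> > 0\<close>] by metis
  show "\<exists>\<delta>>0. \<forall>I::(real \<times> real) set. finite I \<longrightarrow>
        (\<forall>(x, y)\<in>I. a \<le> x \<and> x \<le> y \<and> y \<le> b) \<longrightarrow>
        pairwise (\<lambda>(x, y) (x', y'). {x<..<y} \<inter> {x'<..<y'} = {}) I \<longrightarrow>
        (\<Sum>(x, y)\<in>I. y - x) < \<delta> \<longrightarrow> (\<Sum>(x, y)\<in>I. dist (f (c + x)) (f (c + y))) < \<epsilon>"
  proof (intro exI[of _ d] conjI allI impI \<open>d > 0\<close>)
    fix I :: "(real \<times> real) set"
    assume I: "finite I" "\<forall>(x, y)\<in>I. a \<le> x \<and> x \<le> y \<and> y \<le> b"
      "pairwise (\<lambda>(x, y) (x', y'). {x<..<y} \<inter> {x'<..<y'} = {}) I"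
      "(\<Sum>(x, y)\<in>I. y - x) < d"
    define \<tau> where "\<tau> = (\<lambda>(x, y). (c + x, c + y))"
    have inj: "inj_on \<tau> I" by (auto simp: inj_on_def \<tau>_def)
    have "(\<Sum>(x, y)\<in>\<tau> ` I. dist (f x) (f y)) < \<epsilon>"
    proof (rule d(2))
      show "pairwise (\<lambda>(x, y) (x', y'). {x<..<y} \<inter> {x'<..<y'} = {}) (\<tau> ` I)"
        unfolding pairwise_image
      proof (rule pairwise_mono[OF I(3) _ order_refl])
        fix p q :: "real \<times> real"
        assume *: "(\<lambda>(x, y) (x', y'). {x<..<y} \<inter> {x'<..<y'} = {}) p q"
        obtain x y x' y' where pq: "p = (x, y)" "q = (x', y')" by fastforce
        have "t \<notin> {c + x<..<c + y} \<inter> {c + x'<..<c + y'}" for t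
        proof
          assume "t \<in> {c + x<..<c + y} \<inter> {c + x'<..<c + y'}"
          then have "t - c \<in> {x<..<y} \<inter> {x'<..<y'}" by auto
          then show False using * pq by auto
        qed
        then show "\<tau> p \<noteq> \<tau> q \<longrightarrow>
          (\<lambda>(x, y) (x', y'). {x<..<y} \<inter> {x'<..<y'} = {}) (\<tau> p) (\<tau> q)"
          unfolding \<tau>_def pq by (simp add: set_eq_iff)
      qed
    qed (use I inj in \<open>auto simp: \<tau>_def sum.reindex case_prod_unfold\<close>)
    then show "(\<Sum>(x, y)\<in>I. dist (f (c + x)) (f (c + y))) < \<epsilon>"
      using inj by (simp add: sum.reindex \<tau>_def case_prod_unfold)
  qed
qed

lemma absolutely_continuous_on_interval_imp_continuous_on:
  fixes f :: "real \<Rightarrow> 'a::metric_space"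
  assumes f: "absolutely_continuous_on_interval a b f"
  shows "continuous_on {a..b} f"
  unfolding continuous_on_iff
proof (intro ballI allI impI)
  fix x \<epsilon> :: real assume x: "x \<in> {a..b}" and "\<epsilon> > 0"
  obtain d where d: "d > 0"
    "\<And>I. \<lbrakk>finite I; \<And>x y. (x, y) \<in> I \<Longrightarrow> a \<le> x \<and> x \<le> y \<and> y \<le> b;
       pairwise (\<lambda>(x, y) (x', y'). {x<..<y} \<inter> {x'<..<y'} = {}) I;
       (\<Sum>(x, y)\<in>I. y - x) < d\<rbrakk> \<Longrightarrow> (\<Sum>(x, y)\<in>I. dist (f x) (f y)) < \<epsilon>"
    using absolutely_continuous_on_intervalD[OF f \<open>\<epsilon> > 0\<close>] by metis
  have "dist (f y) (f x) < \<epsilon>" if y: "y \<in> {a..b}" "dist y x < d" for y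
  proof -
    have "(\<Sum>(u, v)\<in>{(min x y, max x y)}. dist (f u) (f v)) < \<epsilon>"
      by (rule d(2)) (use x y in \<open>auto simp: dist_real_def\<close>)
    then show ?thesis
      by (cases "x \<le> y") (simp_all add: dist_commute min_def max_def)
  qed
  then show "\<exists>d>0. \<forall>x'\<in>{a..b}. dist x' x < d \<longrightarrow> dist (f x') (f x) < \<epsilon>"
    using d(1) by blast
qed

text \<open>Squaring is Lipschitz only on bounded sets; compactness of the image supplies the bound
  \<open>M\<close>.\<close>

lemma absolutely_continuous_on_interval_power2_norm:
  fixes f :: "real \<Rightarrow> 'a::real_normed_vector"
  assumes f: "absolutely_continuous_on_interval a b f"
  shows "absolutely_continuous_on_interval a b (\<lambda>t. (norm (f t))\<^sup>2)"
proof -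
  have "compact (f ` {a..b})"
    using absolutely_continuous_on_interval_imp_continuous_on[OF f] by (rule compact_continuous_image) simp
  then obtain M where M: "\<And>t. t \<in> {a..b} \<Longrightarrow> norm (f t) \<le> M"
    using compact_imp_bounded bounded_iff by (metis image_eqI)
  show ?thesis
  proof (rule absolutely_continuous_on_interval_comparison[OF f f])
    fix x y assume xy: "x \<in> {a..b}" "y \<in> {a..b}"
    have "dist ((norm (f x))\<^sup>2) ((norm (f y))\<^sup>2) = \<bar>norm (f x) - norm (f y)\<bar> * (norm (f x) + norm (f y))"
      by (simp add: dist_real_def power2_eq_square square_diff_square_factored abs_mult)
    also have "\<dots> \<le> dist (f x) (f y) * (M + M)"
      using M xy by (intro mult_mono add_mono) (auto simp: dist_norm norm_triangle_ineq3)
    finally show "dist ((norm (f x))\<^sup>2) ((norm (f y))\<^sup>2) \<le> M * (dist (f x) (f y) + dist (f x) (f y))"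
      by (simp add: algebra_simps)
  qed
qed

text \<open>Stands in for the fundamental theorem of calculus. Increments over a fine tagged
  division telescope to \<open>f b - f a\<close>. Tags off \<open>N\<close> are controlled by the
  derivative; tags in \<open>N\<close> by absolute continuity, because their intervals lie in an
  open set of small measure.\<close>

lemma absolutely_continuous_nonpos_derivative_imp_le:
  fixes f :: "real \<Rightarrow> real"
  assumes ac: "absolutely_continuous_on_interval a b f" and "a \<le> b"
    and N: "negligible N"
    and deriv: "\<And>t. t \<in> {a..b} - N \<Longrightarrow> \<exists>d\<le>0. (f has_real_derivative d) (at t within {a..b})"
  shows "f b \<le> f a"
proof (rule field_le_epsilon)
  fix e :: real assume "e > 0"
  \<comment> \<open>Intervals tagged in \<open>N\<close> will cost \<epsilon> in total, the others
    \<epsilon> times b - a.\<close>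
  define \<epsilon> where "\<epsilon> = e / (1 + (b - a))"
  have "\<epsilon> > 0" unfolding \<epsilon>_def using \<open>e > 0\<close> \<open>a \<le> b\<close> by simp
  obtain \<delta> where "\<delta> > 0" and \<delta>:
    "\<And>I. \<lbrakk>finite I; \<And>x y. (x, y) \<in> I \<Longrightarrow> a \<le> x \<and> x \<le> y \<and> y \<le> b;
       pairwise (\<lambda>(x, y) (x', y'). {x<..<y} \<inter> {x'<..<y'} = {}) I;
       (\<Sum>(x, y)\<in>I. y - x) < \<delta>\<rbrakk> \<Longrightarrow> (\<Sum>(x, y)\<in>I. dist (f x) (f y)) < \<epsilon>"
    using absolutely_continuous_on_intervalD[OF ac \<open>\<epsilon> > 0\<close>] by metis
  have "N \<in> sets lebesgue" using N negligible_iff_null_sets by blast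
  then obtain U where U: "open U" "N \<subseteq> U" "U - N \<in> lmeasurable"
      "emeasure lebesgue (U - N) < ennreal \<delta>"
    using sets_lebesgue_outer_open \<open>\<delta> > 0\<close> by metis
  have eqU: "U = (U - N) \<union> N" using U(2) by auto
  have U_meas: "U \<in> lmeasurable"
    using fmeasurable.Un[OF U(3) negligible_imp_measurable[OF N]] eqU by simp
  have "measure lebesgue U \<le> measure lebesgue (U - N) + measure lebesgue N"
    using U(3) N \<open>N \<in> sets lebesgue\<close> by (subst eqU) (intro measure_Un_le, auto)
  also have "\<dots> < \<delta>"
    using U(3,4) N \<open>\<delta> > 0\<close> by (simp add: negligible_imp_measure0 emeasure_eq_measure2 ennreal_less_iff)
  finally have U_small: "measure lebesgue U < \<delta>" .
  have "\<exists>r>0. \<forall>u v. a \<le> u \<and> u \<le> t \<and> t \<le> v \<and> v \<le> b \<and> {u..v} \<subseteq> ball t r \<longrightarrow> f v - f u \<le> \<epsilon> * (v - u)"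
    if t: "t \<in> {a..b} - N" for t
  proof -
    obtain d where "d \<le> 0" "(f has_real_derivative d) (at t within {a..b})"
      using deriv[OF t] by blast
    then obtain r where "r > 0" and r: "\<And>y. y \<in> {a..b} \<Longrightarrow> \<bar>y - t\<bar> < r \<Longrightarrow>
        \<bar>f y - f t - d * (y - t)\<bar> \<le> \<epsilon> * \<bar>y - t\<bar>"
      using \<open>\<epsilon> > 0\<close> unfolding has_field_derivative_def has_derivative_within_alt
      by auto
    show ?thesis
    proof (intro exI[of _ r] conjI allI impI \<open>r > 0\<close>)
      fix u v assume uv: "a \<le> u \<and> u \<le> t \<and> t \<le> v \<and> v \<le> b \<and> {u..v} \<subseteq> ball t r"
      then have "u \<in> ball t r" "v \<in> ball t r" by (meson atLeastAtMost_iff order_refl order_trans subsetD)+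
      then have "\<bar>f u - f t - d * (u - t)\<bar> \<le> \<epsilon> * \<bar>u - t\<bar>" "\<bar>f v - f t - d * (v - t)\<bar> \<le> \<epsilon> * \<bar>v - t\<bar>"
        using uv r[of u] r[of v] by (auto simp: dist_real_def)
      moreover have "\<bar>u - t\<bar> = t - u" "\<bar>v - t\<bar> = v - t" using uv by auto
      ultimately have "f v - f u \<le> \<epsilon> * (v - t) + \<epsilon> * (t - u) + (d * (v - t) - d * (u - t))"
        by (simp add: abs_le_iff)
      also have "\<dots> = \<epsilon> * (v - u) + d * (v - u)" by (simp add: algebra_simps)
      also have "\<dots> \<le> \<epsilon> * (v - u)" using \<open>d \<le> 0\<close> uv by (simp add: mult_nonpos_nonneg)
      finally show "f v - f u \<le> \<epsilon> * (v - u)" .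
    qed
  qed
  then obtain r where r_pos: "\<And>t. t \<in> {a..b} - N \<Longrightarrow> r t > 0"
    and r: "\<And>t u v. t \<in> {a..b} - N \<Longrightarrow> a \<le> u \<Longrightarrow> u \<le> t \<Longrightarrow> t \<le> v \<Longrightarrow> v \<le> b \<Longrightarrow>
      {u..v} \<subseteq> ball t (r t) \<Longrightarrow> f v - f u \<le> \<epsilon> * (v - u)"
    by metis
  \<comment> \<open>A tag in \<open>N\<close> keeps its interval inside \<open>U\<close>; other tags
    in \<open>{a..b}\<close> use the radius coming from the derivative. The last case merely makes
    \<gamma> a gauge on the whole line.\<close>
  define \<gamma> where "\<gamma> t = (if t \<in> N then U else if t \<in> {a..b} then ball t (r t) else ball t 1)" for t
  have "gauge \<gamma>"
    using U(1,2) r_pos unfolding gauge_def \<gamma>_def by auto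
  then obtain p where p: "p tagged_division_of {a..b}" "\<gamma> fine p"
    by (rule fine_division_exists_real)
  note pD = tagged_division_ofD[OF p(1)]
  have interval: "\<exists>u v. K = {u..v} \<and> a \<le> u \<and> u \<le> x \<and> x \<le> v \<and> v \<le> b \<and> {u..v} \<subseteq> \<gamma> x"
    if xK: "(x, K) \<in> p" for x K
  proof -
    obtain u v where K: "K = {u..v}" using pD(4)[OF xK] by auto
    then have "u \<le> x" "x \<le> v" using pD(2)[OF xK] by auto
    moreover have "{u..v} \<subseteq> {a..b}" using pD(3)[OF xK] K by auto
    moreover have "{u..v} \<subseteq> \<gamma> x" using p(2) xK K unfolding fine_def by auto
    ultimately show ?thesis using K by auto
  qed
  have nonempty: "K \<noteq> {}" if "(x, K) \<in> p" for x K
    using pD(2)[OF that] by auto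
  define p1 where "p1 = {(x, K) \<in> p. x \<in> N}"
  have "p1 \<subseteq> p" unfolding p1_def by auto
  have "finite p1" using pD(1) \<open>p1 \<subseteq> p\<close> finite_subset by blast
  have p1: "p1 tagged_partial_division_of {a..b}"
    using p(1) \<open>p1 \<subseteq> p\<close> tagged_partial_division_subset unfolding tagged_division_of_def by blast
  note p1_Un = tagged_partial_division_of_Union_self[OF p1]
  note snd_p1 = division_ofD[OF division_of_tagged_division[OF p1_Un]]
  \<comment> \<open>Absolute continuity speaks of sets of endpoint pairs, so the tags are dropped.
    The intervals are nonempty, hence determined by their endpoints.\<close>
  define I where "I = (\<lambda>K. (Inf K, Sup K)) ` snd ` p1"
  have I_D: "a \<le> u \<and> u \<le> v \<and> v \<le> b \<and> {u..v} \<subseteq> U \<and> {u..v} \<in> snd ` p1" if uv: "(u, v) \<in> I" for u v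
  proof -
    obtain x K where xK: "(x, K) \<in> p1" "u = Inf K" "v = Sup K" using uv unfolding I_def by auto
    then obtain u' v' where "K = {u'..v'}" "a \<le> u'" "u' \<le> x" "x \<le> v'" "v' \<le> b" "{u'..v'} \<subseteq> \<gamma> x"
      using interval[of x K] \<open>p1 \<subseteq> p\<close> by auto
    moreover have "x \<in> N" using xK unfolding p1_def by auto
    ultimately show ?thesis using xK unfolding \<gamma>_def by (force simp: image_iff)
  qed
  have inj: "inj_on (\<lambda>K. (Inf K, Sup K)) (snd ` p1)"
  proof (rule inj_onI)
    fix K K' :: "real set"
    assume K: "K \<in> snd ` p1" "K' \<in> snd ` p1" "(Inf K, Sup K) = (Inf K', Sup K')"
    then obtain u v u' v' where "K = {u..v}" "u \<le> v" "K' = {u'..v'}" "u' \<le> v'"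
      using interval \<open>p1 \<subseteq> p\<close> by (smt (verit) imageE prod.collapse subsetD)
    then show "K = K'" using K(3) by simp
  qed
  have I_disj: "pairwise (\<lambda>(x, y) (x', y'). {x<..<y} \<inter> {x'<..<y'} = {}) I"
  proof (rule pairwiseI, simp only: split_paired_all prod.case)
    fix x y x' y' assume *: "(x, y) \<in> I" "(x', y') \<in> I" "(x, y) \<noteq> (x', y')"
    then have "{x..y} \<noteq> {x'..y'}" using I_D by (metis Icc_eq_Icc)
    then have "interior {x..y} \<inter> interior {x'..y'} = {}"
      using * I_D by (intro snd_p1(5)) auto
    then show "{x<..<y} \<inter> {x'<..<y'} = {}" by simp
  qed
  have "finite I" unfolding I_def using \<open>finite p1\<close> by simp
  \<comment> \<open>The open intervals are pairwise disjoint and contained in \<open>U\<close>, so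
    their total length is at most the measure of \<open>U\<close>.\<close>
  have "(\<Sum>(x, y)\<in>I. y - x) = (\<Sum>q\<in>I. measure lebesgue {fst q<..<snd q})"
    using I_D by (intro sum.cong) (auto simp: split_beta)
  also have "\<dots> = measure lebesgue (\<Union>q\<in>I. {fst q<..<snd q})"
    using \<open>finite I\<close> I_disj
    by (intro measure_negligible_finite_Union_image[symmetric])
      (auto simp: pairwise_def split_beta)
  also have "\<dots> \<le> measure lebesgue U"
    using I_D U_meas \<open>finite I\<close> by (intro measure_mono_fmeasurable) (fastforce, auto)
  also have "\<dots> < \<delta>" by (rule U_small)
  finally have sum_I: "(\<Sum>(x, y)\<in>I. dist (f x) (f y)) < \<epsilon>"
    using I_D \<open>finite I\<close> I_disj by (intro \<delta>) auto
  \<comment> \<open>\<open>Inf\<close> of the empty set is unspecified. With the value 0 there,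
    \<open>d\<close> vanishes on every interval with empty interior, so different tags sharing a
    degenerate interval can be merged.\<close>
  define d where "d K = (if K = {} then 0 else dist (f (Inf K)) (f (Sup K)))" for K
  have "(\<Sum>(x, K)\<in>p1. f (Sup K) - f (Inf K)) \<le> (\<Sum>(x, K)\<in>p1. dist (f (Inf K)) (f (Sup K)))"
    by (intro sum_mono) (auto simp: dist_real_def)
  also have "\<dots> = (\<Sum>(x, K)\<in>p1. d K)"
    using nonempty \<open>p1 \<subseteq> p\<close> unfolding d_def by (intro sum.cong) auto
  also have "\<dots> = (\<Sum>K\<in>snd ` p1. d K)"
    by (rule sum.over_tagged_division_lemma[OF p1_Un]) (auto simp: d_def)
  also have "\<dots> = (\<Sum>K\<in>snd ` p1. dist (f (Inf K)) (f (Sup K)))"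
    using nonempty \<open>p1 \<subseteq> p\<close> unfolding d_def by (intro sum.cong) auto
  also have "\<dots> = (\<Sum>(x, y)\<in>I. dist (f x) (f y))"
    unfolding I_def by (simp add: sum.reindex[OF inj])
  finally have sum1: "(\<Sum>(x, K)\<in>p1. f (Sup K) - f (Inf K)) \<le> \<epsilon>" using sum_I by linarith
  have "(\<Sum>(x, K)\<in>p - p1. f (Sup K) - f (Inf K)) \<le> (\<Sum>(x, K)\<in>p - p1. \<epsilon> * measure lborel K)"
  proof (intro sum_mono, clarify)
    fix x K assume "(x, K) \<in> p" "(x, K) \<notin> p1"
    then have "x \<notin> N" unfolding p1_def by auto
    obtain u v where uv: "K = {u..v}" "a \<le> u" "u \<le> x" "x \<le> v" "v \<le> b" "{u..v} \<subseteq> \<gamma> x"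
      using interval \<open>(x, K) \<in> p\<close> by blast
    then have "f v - f u \<le> \<epsilon> * (v - u)"
      using \<open>x \<notin> N\<close> by (intro r[of x]) (auto simp: \<gamma>_def)
    then show "f (Sup K) - f (Inf K) \<le> \<epsilon> * measure lborel K" using uv by simp
  qed
  also have "\<dots> \<le> (\<Sum>(x, K)\<in>p. \<epsilon> * measure lborel K)"
    using pD(1) \<open>\<epsilon> > 0\<close> by (intro sum_mono2) auto
  also have "\<dots> = \<epsilon> * (b - a)"
    using additive_content_tagged_division[of p a b] p(1) \<open>a \<le> b\<close>
    by (simp add: sum_distrib_left[symmetric] case_prod_unfold)
  finally have sum2: "(\<Sum>(x, K)\<in>p - p1. f (Sup K) - f (Inf K)) \<le> \<epsilon> * (b - a)" .
  have "f b - f a = (\<Sum>(x, K)\<in>p. f (Sup K) - f (Inf K))"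
    using additive_tagged_division_1[OF \<open>a \<le> b\<close> p(1), of f] by simp
  also have "\<dots> = (\<Sum>(x, K)\<in>p - p1. f (Sup K) - f (Inf K)) + (\<Sum>(x, K)\<in>p1. f (Sup K) - f (Inf K))"
    using pD(1) \<open>p1 \<subseteq> p\<close> by (rule sum.subset_diff[rotated])
  also have "\<dots> \<le> \<epsilon> * (1 + (b - a))" using sum1 sum2 by (simp add: algebra_simps)
  also have "\<dots> = e" using \<open>a \<le> b\<close> unfolding \<epsilon>_def by simp
  finally show "f b \<le> f a + e" by simp
qed

section \<open>Orbits of contraction semigroups\<close>

text \<open>Semigroup orbits first come with right derivatives only, hence the one-sided form. After
  subtracting a line of slope slightly above \<open>c\<close>, the last point with nonpositive
  remainder would have to be followed by smaller values, not by positive ones.\<close>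

lemma right_derivative_le_imp_le:
  fixes f :: "real \<Rightarrow> real"
  assumes cont: "continuous_on {a..b} f" and "a \<le> b"
    and deriv: "\<And>t. a \<le> t \<Longrightarrow> t < b \<Longrightarrow> \<exists>d\<le>c. (f has_real_derivative d) (at_right t)"
  shows "f b \<le> f a + c * (b - a)"
proof (rule ccontr)
  assume "\<not> ?thesis"
  then have gt: "f b > f a + c * (b - a)" by simp
  then have "a < b" using \<open>a \<le> b\<close> by (cases "a = b") auto
  \<comment> \<open>Half of the excess of the mean slope over \<open>c\<close>, so that
    \<open>g b\<close> stays positive.\<close>
  define e where "e = (f b - f a - c * (b - a)) / (2 * (b - a))"
  have "e > 0" unfolding e_def using gt \<open>a < b\<close> by simp
  define g where "g t = f t - f a - (c + e) * (t - a)" for t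
  have "g b = (f b - f a - c * (b - a)) / 2"
    using \<open>a < b\<close> unfolding g_def e_def by (simp add: field_simps)
  then have "g b > 0" using gt by simp
  have g_cont: "continuous_on {a..b} g"
    unfolding g_def by (intro continuous_intros cont)
  define Z where "Z = {a..b} \<inter> g -` {..0}"
  have "closed Z" unfolding Z_def
    by (intro continuous_closed_preimage[OF g_cont]) auto
  have "a \<in> Z" unfolding Z_def g_def using \<open>a \<le> b\<close> by simp
  have "bdd_above Z" unfolding Z_def by (auto intro: bdd_aboveI)
  define s where "s = Sup Z"
  have "s \<in> Z" unfolding s_def using \<open>a \<in> Z\<close> \<open>closed Z\<close> \<open>bdd_above Z\<close>
    by (intro closed_contains_Sup) auto
  then have s: "a \<le> s" "s \<le> b" "g s \<le> 0" unfolding Z_def by auto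
  then have "s < b" using \<open>g b > 0\<close> by (cases "s = b") auto
  have after: "g t > 0" if "s < t" "t \<le> b" for t
  proof (rule ccontr)
    assume "\<not> g t > 0"
    then have "t \<in> Z" using that s unfolding Z_def by auto
    then have "t \<le> s" unfolding s_def using \<open>bdd_above Z\<close> by (rule cSup_upper)
    then show False using that by simp
  qed
  obtain d where "d \<le> c" and d: "(f has_real_derivative d) (at_right s)"
    using deriv s \<open>s < b\<close> by blast
  have "(g has_real_derivative d - (c + e)) (at_right s)"
    unfolding g_def by (auto intro!: derivative_eq_intros d)
  moreover have "d - (c + e) < 0" using \<open>d \<le> c\<close> \<open>e > 0\<close> by simp
  ultimately obtain r where "r > 0" "\<And>h. h > 0 \<Longrightarrow> s + h \<in> {s<..} \<Longrightarrow> h < r \<Longrightarrow> g s > g (s + h)"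
    using has_real_derivative_neg_dec_right by blast
  then have "g s > g (s + min (r/2) (b - s))"
    using \<open>s < b\<close> by auto
  moreover have "g (s + min (r/2) (b - s)) > 0"
    using \<open>s < b\<close> \<open>r > 0\<close> by (intro after) auto
  ultimately show False using s by simp
qed

lemma has_vector_derivative_within_quotient:
  "(f has_vector_derivative D) (at t within S) \<longleftrightarrow>
    ((\<lambda>x. (f x - f t) /\<^sub>R (x - t)) \<longlongrightarrow> D) (at t within S)"
proof -
  have eq: "norm ((f x - f t) /\<^sub>R (x - t) - D) = norm (f x - f t - (x - t) *\<^sub>R D) / norm (x - t)"
    if "x \<noteq> t" for x
  proof -
    have "(f x - f t) /\<^sub>R (x - t) - D = (f x - f t - (x - t) *\<^sub>R D) /\<^sub>R (x - t)"
      using that by (simp add: scaleR_diff_right)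
    then show ?thesis by (simp add: divide_inverse_commute)
  qed
  have "((\<lambda>x. (f x - f t) /\<^sub>R (x - t)) \<longlongrightarrow> D) (at t within S) \<longleftrightarrow>
     ((\<lambda>x. norm ((f x - f t) /\<^sub>R (x - t) - D)) \<longlongrightarrow> 0) (at t within S)"
    unfolding tendsto_norm_zero_iff by (rule LIM_zero_iff[symmetric])
  also have "\<dots> \<longleftrightarrow> ((\<lambda>x. norm (f x - f t - (x - t) *\<^sub>R D) / norm (x - t)) \<longlongrightarrow> 0) (at t within S)"
    by (intro filterlim_cong refl) (auto simp: eventually_at_filter eq)
  finally show ?thesis
    unfolding has_vector_derivative_def has_derivative_iff_norm
    by (simp add: bounded_linear_scaleR_left)
qed

lemma has_vector_derivative_power2_norm:
  fixes f :: "real \<Rightarrow> 'a::real_inner"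
  assumes "(f has_vector_derivative D) (at t within S)"
  shows "((\<lambda>t. (norm (f t))\<^sup>2) has_real_derivative 2 * (f t \<bullet> D)) (at t within S)"
proof -
  have "((\<lambda>t. f t \<bullet> f t) has_derivative (\<lambda>h. f t \<bullet> (h *\<^sub>R D) + (h *\<^sub>R D) \<bullet> f t)) (at t within S)"
    using assms unfolding has_vector_derivative_def by (intro has_derivative_inner)
  then show ?thesis
    unfolding has_field_derivative_def power2_norm_eq_inner
    by (rule has_derivative_eq_rhs) (auto simp: inner_commute)
qed

lemma generates_C0_semigroupD:
  assumes "generates_C0_semigroup D L S"
  shows "S 0 z = z"
    and "t \<ge> 0 \<Longrightarrow> bounded_linear (S t)"
    and "s \<ge> 0 \<Longrightarrow> t \<ge> 0 \<Longrightarrow> S (s + t) z = S s (S t z)"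
    and "((\<lambda>t. S t z) \<longlongrightarrow> z) (at_right 0)"
    and "z \<in> D \<Longrightarrow> ((\<lambda>t. (S t z - z) /\<^sub>R t) \<longlongrightarrow> L z) (at_right 0)"
    and "((\<lambda>t. (S t z - z) /\<^sub>R t) \<longlongrightarrow> y) (at_right 0) \<Longrightarrow> z \<in> D"
proof -
  note gen = assms[unfolded generates_C0_semigroup_def]
  note C0 = gen[THEN conjunct1] and D = gen[THEN conjunct2, THEN conjunct1]
    and L = gen[THEN conjunct2, THEN conjunct2]
  show "S 0 z = z"
    and "t \<ge> 0 \<Longrightarrow> bounded_linear (S t)"
    and "s \<ge> 0 \<Longrightarrow> t \<ge> 0 \<Longrightarrow> S (s + t) z = S s (S t z)"
    and "((\<lambda>t. S t z) \<longlongrightarrow> z) (at_right 0)"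
    using C0 unfolding C0_semigroup_def by simp_all
  show "z \<in> D \<Longrightarrow> ((\<lambda>t. (S t z - z) /\<^sub>R t) \<longlongrightarrow> L z) (at_right 0)"
    by (rule bspec[OF L])
  show "((\<lambda>t. (S t z - z) /\<^sub>R t) \<longlongrightarrow> y) (at_right 0) \<Longrightarrow> z \<in> D"
    by (subst D, rule CollectI, rule exI)
qed

text \<open>\<open>S t\<close> is continuous and commutes with \<open>S h\<close>, so it carries the
  difference quotients of \<open>z\<close> to those of \<open>S t z\<close>. Existence of the limit
  is membership in the domain, its uniqueness gives the value.\<close>

lemma generator_in_domain:
  assumes S: "generates_C0_semigroup D L S" and "z \<in> D" "t \<ge> 0"
  shows "S t z \<in> D" "L (S t z) = S t (L z)"
proof -
  note C0 = generates_C0_semigroupD[OF S]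
  have bl: "bounded_linear (S t)" using C0(2) \<open>t \<ge> 0\<close> .
  interpret bounded_linear "S t" by (fact bl)
  have "((\<lambda>h. (S h z - z) /\<^sub>R h) \<longlongrightarrow> L z) (at_right 0)"
    using C0(5) \<open>z \<in> D\<close> .
  then have "((\<lambda>h. S t ((S h z - z) /\<^sub>R h)) \<longlongrightarrow> S t (L z)) (at_right 0)"
    by (rule tendsto)
  moreover have "\<forall>\<^sub>F h in at_right 0. S t ((S h z - z) /\<^sub>R h) = (S h (S t z) - S t z) /\<^sub>R h"
  proof (rule eventually_at_right_less[THEN eventually_mono])
    fix h :: real assume "0 < h"
    then have "S t (S h z) = S h (S t z)"
      using C0(3)[of t h z] C0(3)[of h t z] \<open>t \<ge> 0\<close> by (simp add: add.commute)
    then show "S t ((S h z - z) /\<^sub>R h) = (S h (S t z) - S t z) /\<^sub>R h"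
      by (simp add: scaleR diff)
  qed
  ultimately have lim: "((\<lambda>h. (S h (S t z) - S t z) /\<^sub>R h) \<longlongrightarrow> S t (L z)) (at_right 0)"
    using tendsto_cong by fast
  then show "S t z \<in> D" by (rule C0(6))
  then have "((\<lambda>h. (S h (S t z) - S t z) /\<^sub>R h) \<longlongrightarrow> L (S t z)) (at_right 0)"
    by (rule C0(5))
  then show "L (S t z) = S t (L z)"
    using lim tendsto_unique trivial_limit_at_right_real by blast
qed

lemma semigroup_has_right_derivative:
  assumes S: "generates_C0_semigroup D L S" and "z \<in> D" "t \<ge> 0"
  shows "((\<lambda>t. S t z) has_vector_derivative L (S t z)) (at_right t)"
proof -
  note C0 = generates_C0_semigroupD[OF S]
  have "((\<lambda>h. (S h (S t z) - S t z) /\<^sub>R h) \<longlongrightarrow> L (S t z)) (at_right 0)"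
    using generator_in_domain(1)[OF assms] by (rule C0(5))
  moreover have "\<forall>\<^sub>F h in at_right 0.
      (S h (S t z) - S t z) /\<^sub>R h = (S (h + t) z - S t z) /\<^sub>R ((h + t) - t)"
    by (rule eventually_at_right_less[THEN eventually_mono]) (simp add: C0(3) \<open>t \<ge> 0\<close>)
  ultimately have "((\<lambda>h. (S (h + t) z - S t z) /\<^sub>R ((h + t) - t)) \<longlongrightarrow> L (S t z)) (at_right 0)"
    using tendsto_cong by fast
  then show ?thesis
    unfolding has_vector_derivative_within_quotient by (subst filterlim_at_right_to_0)
qed

text \<open>Without the uniform boundedness principle, left continuity of the orbits is not
  automatic; the a priori bound on \<open>D\<close> supplies it.\<close>

lemma semigroup_orbit_continuous:
  assumes S: "generates_C0_semigroup D L S" and "subspace D" and "z \<in> D"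
    and linear: "\<And>x y. x \<in> D \<Longrightarrow> y \<in> D \<Longrightarrow> L (x - y) = L x - L y"
    and bound: "\<And>t z. t \<ge> 0 \<Longrightarrow> z \<in> D \<Longrightarrow> norm (S t z) \<le> M * graph_norm L z"
  shows "continuous_on {0..} (\<lambda>t. S t z)"
proof -
  note C0 = generates_C0_semigroupD[OF S]
  \<comment> \<open>This bounds an increment of length \<open>h\<close> uniformly in the starting
    time, so the same estimate started at the earlier time yields left continuity. The absolute
    value covers an \<open>M\<close> of any sign.\<close>
  define \<omega> where "\<omega> h = \<bar>M\<bar> * (norm (S h z - z) + norm (S h (L z) - L z))" for h
  have "((\<lambda>h. S h z) \<longlongrightarrow> z) (at_right 0)" "((\<lambda>h. S h (L z)) \<longlongrightarrow> L z) (at_right 0)"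
    by (rule C0(4))+
  then have "(\<omega> \<longlongrightarrow> \<bar>M\<bar> * (norm (z - z) + norm (L z - L z))) (at_right 0)"
    unfolding \<omega>_def by (intro tendsto_intros)
  then have \<omega>: "(\<omega> \<longlongrightarrow> 0) (at_right 0)" by simp
  have step: "norm (S (t + h) z - S t z) \<le> \<omega> h" if "t \<ge> 0" "h > 0" for t h
  proof -
    have dom: "S h z \<in> D" "L (S h z) = S h (L z)" using generator_in_domain[OF S \<open>z \<in> D\<close>] that by auto
    have "S (t + h) z - S t z = S t (S h z - z)"
      using that by (simp add: C0(3) bounded_linear.linear[OF C0(2)] linear_diff)
    also have "norm \<dots> \<le> M * graph_norm L (S h z - z)"
      using dom \<open>z \<in> D\<close> \<open>subspace D\<close> that by (intro bound subspace_diff)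
    also have "\<dots> = M * (norm (S h z - z) + norm (S h (L z) - L z))"
      using dom \<open>z \<in> D\<close> by (simp add: graph_norm_def linear)
    also have "\<dots> \<le> \<omega> h" unfolding \<omega>_def by (intro mult_right_mono) auto
    finally show ?thesis .
  qed
  show ?thesis
    unfolding continuous_on_iff
  proof (intro ballI allI impI)
    fix t \<epsilon> :: real assume "t \<in> {0..}" "\<epsilon> > 0"
    then have "\<forall>\<^sub>F h in at_right 0. \<omega> h < \<epsilon>" using \<omega> by (simp add: order_tendstoD)
    then obtain r where "r > 0" and r: "\<And>h. 0 < h \<Longrightarrow> h < r \<Longrightarrow> \<omega> h < \<epsilon>"
      unfolding eventually_at_right_field by auto
    have "dist (S t' z) (S t z) < \<epsilon>" if "t' \<in> {0..}" "dist t' t < r" for t'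
    proof (cases t' t rule: linorder_cases)
      case less
      then show ?thesis
        using step[of t' "t - t'"] r[of "t - t'"] that
        by (simp add: dist_norm norm_minus_commute)
    next
      case greater
      then show ?thesis
        using step[of t "t' - t"] r[of "t' - t"] that \<open>t \<in> {0..}\<close>
        by (simp add: dist_norm)
    qed (simp add: \<open>\<epsilon> > 0\<close>)
    then show "\<exists>d>0. \<forall>t'\<in>{0..}. dist t' t < d \<longrightarrow> dist (S t' z) (S t z) < \<epsilon>"
      using \<open>r > 0\<close> by blast
  qed
qed

text \<open>The energy has nonpositive right derivative by dissipativity. Continuity is a separate
  hypothesis because right derivatives say nothing about left limits.\<close>

lemma semigroup_contraction_on_domain:
  fixes S :: "real \<Rightarrow> 'h::real_inner \<Rightarrow> 'h"
  assumes S: "generates_C0_semigroup D L S" and "z \<in> D" "t \<ge> 0"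
    and dissipative: "\<And>x. x \<in> D \<Longrightarrow> L x \<bullet> x \<le> 0"
    and cont: "continuous_on {0..} (\<lambda>t. S t z)"
  shows "norm (S t z) \<le> norm z"
proof -
  have "(norm (S t z))\<^sup>2 \<le> (norm (S 0 z))\<^sup>2 + 0 * (t - 0)"
  proof (rule right_derivative_le_imp_le)
    show "continuous_on {0..t} (\<lambda>t. (norm (S t z))\<^sup>2)"
      by (intro continuous_intros continuous_on_subset[OF cont]) auto
  next
    fix s :: real assume "0 \<le> s"
    then have "2 * (S s z \<bullet> L (S s z)) \<le> 0"
      using dissipative[of "S s z"] generator_in_domain[OF S \<open>z \<in> D\<close>] by (simp add: inner_commute)
    then show "\<exists>d\<le>0. ((\<lambda>t. (norm (S t z))\<^sup>2) has_real_derivative d) (at_right s)"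
      using has_vector_derivative_power2_norm semigroup_has_right_derivative[OF S \<open>z \<in> D\<close> \<open>0 \<le> s\<close>]
      by blast
  qed fact
  then have "(norm (S t z))\<^sup>2 \<le> (norm z)\<^sup>2"
    by (simp only: generates_C0_semigroupD(1)[OF S] mult_zero_left add_0_right)
  then show ?thesis by (rule power2_le_imp_le) simp
qed

lemma contraction_on_dense_subset:
  assumes "bounded_linear T" "closure D = UNIV" "\<And>z. z \<in> D \<Longrightarrow> norm (T z) \<le> norm z"
  shows "norm (T z) \<le> norm z"
proof -
  interpret bounded_linear T by fact
  have "closed {z. norm (T z) \<le> norm z}"
    by (intro closed_Collect_le continuous_on_norm linear_continuous_on[OF assms(1)] continuous_on_id)
  then have "closure D \<subseteq> {z. norm (T z) \<le> norm z}"
    using assms by (intro closure_minimal) auto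
  then show ?thesis using assms by auto
qed

text \<open>Only the left derivative is new. Writing \<open>S t\<close> as \<open>S (t - h)\<close>
  after \<open>S h\<close> expresses its error as \<open>S (t - h)\<close> applied to quantities
  that vanish as h tends to 0; contraction removes the varying operator in front.\<close>

lemma contraction_semigroup_has_derivative:
  assumes S: "generates_C0_semigroup D L S" and "z \<in> D" "t > 0"
    and contraction: "\<And>t z. t \<ge> 0 \<Longrightarrow> norm (S t z) \<le> norm z"
  shows "((\<lambda>t. S t z) has_vector_derivative L (S t z)) (at t)"
proof -
  note C0 = generates_C0_semigroupD[OF S]
  define q where "q h = (S h z - z) /\<^sub>R h" for h
  have q: "(q \<longlongrightarrow> L z) (at_right 0)" unfolding q_def using C0(5) \<open>z \<in> D\<close> .
  have "((\<lambda>h. S h (L z)) \<longlongrightarrow> L z) (at_right 0)" by (rule C0(4))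
  then have "((\<lambda>h. norm (q h - L z) + norm (S h (L z) - L z)) \<longlongrightarrow> norm (L z - L z) + norm (L z - L z)) (at_right 0)"
    by (intro tendsto_intros q)
  then have bound: "((\<lambda>h. norm (q h - L z) + norm (S h (L z) - L z)) \<longlongrightarrow> 0) (at_right 0)" by simp
  have lin: "S r (x - y) = S r x - S r y" "S r (c *\<^sub>R x) = c *\<^sub>R S r x" if "r \<ge> 0" for r x y c
    using bounded_linear.linear[OF C0(2)[OF that]] by (simp_all add: linear_diff linear_scale)
  have "((\<lambda>h. (S (t - h) z - S t z) /\<^sub>R ((t - h) - t) - S t (L z)) \<longlongrightarrow> 0) (at_right 0)"
  proof (rule Lim_null_comparison[OF _ bound])
    have "\<forall>\<^sub>F h in at_right 0. 0 < h \<and> h < t"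
      using \<open>t > 0\<close> eventually_at_right_field by blast
    then show "\<forall>\<^sub>F h in at_right 0. norm ((S (t - h) z - S t z) /\<^sub>R ((t - h) - t) - S t (L z))
        \<le> norm (q h - L z) + norm (S h (L z) - L z)"
    proof (rule eventually_mono)
      fix h assume h: "0 < h \<and> h < t"
      have split: "S t w = S (t - h) (S h w)" for w
        using C0(3)[of "t - h" h w] h by simp
      have "(S (t - h) z - S t z) /\<^sub>R ((t - h) - t) = S (t - h) (q h)"
        using h by (simp add: split[of z] q_def lin scaleR_diff_right)
      then have "(S (t - h) z - S t z) /\<^sub>R ((t - h) - t) - S t (L z)
          = S (t - h) (q h - L z) - S (t - h) (S h (L z) - L z)"
        using h by (simp add: split[of "L z"] lin)
      also have "norm \<dots> \<le> norm (S (t - h) (q h - L z)) + norm (S (t - h) (S h (L z) - L z))"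
        by (rule norm_triangle_ineq4)
      also have "\<dots> \<le> norm (q h - L z) + norm (S h (L z) - L z)"
        using h by (intro add_mono contraction) auto
      finally show "norm ((S (t - h) z - S t z) /\<^sub>R ((t - h) - t) - S t (L z))
        \<le> norm (q h - L z) + norm (S h (L z) - L z)" .
    qed
  qed
  then have "((\<lambda>h. (S (t - h) z - S t z) /\<^sub>R ((t - h) - t)) \<longlongrightarrow> S t (L z)) (at_right 0)"
    by (rule LIM_zero_cancel)
  then have "((\<lambda>x. (S x z - S t z) /\<^sub>R (x - t)) \<longlongrightarrow> S t (L z)) (at_left t)"
    unfolding filterlim_at_left_to_right filterlim_at_right_to_0[where a = "-t"] by (simp add: algebra_simps)
  then have "((\<lambda>x. (S x z - S t z) /\<^sub>R (x - t)) \<longlongrightarrow> L (S t z)) (at_left t)"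
    using generator_in_domain[OF S \<open>z \<in> D\<close>] \<open>t > 0\<close> by simp
  moreover have "((\<lambda>x. (S x z - S t z) /\<^sub>R (x - t)) \<longlongrightarrow> L (S t z)) (at_right t)"
    using semigroup_has_right_derivative[OF S \<open>z \<in> D\<close>] \<open>t > 0\<close>
    unfolding has_vector_derivative_within_quotient by simp
  ultimately show ?thesis
    unfolding has_vector_derivative_within_quotient by (simp add: filterlim_split_at)
qed

text \<open>Mean value inequality for vector-valued functions: the orbit is paired with its own
  increment \<open>v\<close>. The speed is bounded by \<open>norm (L z)\<close> since
  \<open>L\<close> commutes with the contractive semigroup.\<close>

lemma contraction_semigroup_orbit_Lipschitz:
  fixes S :: "real \<Rightarrow> 'h::real_inner \<Rightarrow> 'h"
  assumes S: "generates_C0_semigroup D L S" and "z \<in> D" "0 \<le> s" "s \<le> t"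
    and contraction: "\<And>t z. t \<ge> 0 \<Longrightarrow> norm (S t z) \<le> norm z"
    and cont: "continuous_on {0..} (\<lambda>t. S t z)"
  shows "norm (S t z - S s z) \<le> norm (L z) * (t - s)"
proof -
  define v where "v = S t z - S s z"
  have "S t z \<bullet> v \<le> S s z \<bullet> v + (norm (L z) * norm v) * (t - s)"
  proof (rule right_derivative_le_imp_le)
    show "continuous_on {s..t} (\<lambda>t. S t z \<bullet> v)"
      using \<open>0 \<le> s\<close> by (intro continuous_intros continuous_on_subset[OF cont]) auto
  next
    fix r :: real assume "s \<le> r"
    then have "0 \<le> r" using \<open>0 \<le> s\<close> by simp
    have "L (S r z) \<bullet> v \<le> norm (L (S r z)) * norm v"
      by (rule norm_cauchy_schwarz)
    also have "\<dots> \<le> norm (L z) * norm v"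
      using contraction[OF \<open>0 \<le> r\<close>] generator_in_domain[OF S \<open>z \<in> D\<close> \<open>0 \<le> r\<close>]
      by (intro mult_right_mono) auto
    finally have "L (S r z) \<bullet> v \<le> norm (L z) * norm v" .
    moreover have "((\<lambda>t. S t z \<bullet> v) has_real_derivative (L (S r z) \<bullet> v)) (at_right r)"
      unfolding has_real_derivative_iff_has_vector_derivative
      by (rule bounded_linear.has_vector_derivative[OF bounded_linear_inner_left
            semigroup_has_right_derivative[OF S \<open>z \<in> D\<close> \<open>0 \<le> r\<close>]])
    ultimately show "\<exists>d\<le>norm (L z) * norm v. ((\<lambda>t. S t z \<bullet> v) has_real_derivative d) (at_right r)"
      by blast
  qed fact
  then have "v \<bullet> v \<le> (norm (L z) * norm v) * (t - s)"
    unfolding v_def by (simp add: inner_diff_left)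
  then have "norm v * norm v \<le> (norm (L z) * (t - s)) * norm v"
    by (simp add: power2_norm_eq_inner[symmetric] power2_eq_square mult_ac)
  then show ?thesis
    using \<open>s \<le> t\<close> unfolding v_def[symmetric] by (cases "v = 0") auto
qed

section \<open>Strong solutions of dissipative equations\<close>

lemma absolutely_continuous_on_interval_linear_combination:
  fixes f g :: "real \<Rightarrow> 'a::real_normed_vector"
  assumes "absolutely_continuous_on_interval a b f" "absolutely_continuous_on_interval a b g"
  shows "absolutely_continuous_on_interval a b (\<lambda>t. f t + c *\<^sub>R g t)"
proof (rule absolutely_continuous_on_interval_comparison[OF assms])
  fix x y
  have "(f x + c *\<^sub>R g x) - (f y + c *\<^sub>R g y) = (f x - f y) + c *\<^sub>R (g x - g y)"
    by (simp add: algebra_simps)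
  then have "dist (f x + c *\<^sub>R g x) (f y + c *\<^sub>R g y) \<le> dist (f x) (f y) + \<bar>c\<bar> * dist (g x) (g y)"
    unfolding dist_norm by (metis norm_scaleR norm_triangle_ineq)
  also have "\<dots> \<le> (1 + \<bar>c\<bar>) * (dist (f x) (f y) + dist (g x) (g y))"
    by (simp add: algebra_simps)
  finally show "dist (f x + c *\<^sub>R g x) (f y + c *\<^sub>R g y)
      \<le> (1 + \<bar>c\<bar>) * (dist (f x) (f y) + dist (g x) (g y))" .
qed

lemma absolutely_continuous_on_interval_const:
  "absolutely_continuous_on_interval a b (\<lambda>t. c)"
  by (rule absolutely_continuous_on_interval_comparison
      [OF absolutely_continuous_on_interval_ident absolutely_continuous_on_interval_ident, of _ _ _ 1]) simp

lemma strong_solution_has_derivative: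
  assumes "strong_solution D F z0 z"
  obtains N where "negligible N"
    "\<And>t. t \<ge> 0 \<Longrightarrow> t \<notin> N \<Longrightarrow> (z has_vector_derivative F (z t)) (at t within {0..})"
proof -
  have "AE t in lborel. t \<ge> 0 \<longrightarrow> (z has_vector_derivative F (z t)) (at t within {0..})"
    using assms unfolding strong_solution_def by blast
  then have "AE t in lebesgue. t \<ge> 0 \<longrightarrow> (z has_vector_derivative F (z t)) (at t within {0..})"
    by (rule AE_completion)
  then obtain N where "N \<in> null_sets lebesgue"
    "{t \<in> space lebesgue. \<not> (t \<ge> 0 \<longrightarrow> (z has_vector_derivative F (z t)) (at t within {0..}))} \<subseteq> N"
    unfolding eventually_ae_filter by blast
  then show thesis
    by (intro that[of N]) (auto simp: negligible_iff_null_sets)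
qed

lemma strong_solutionD:
  assumes "strong_solution D F z0 z"
  shows "b \<ge> 0 \<Longrightarrow> absolutely_continuous_on_interval 0 b z" "z 0 = z0" "t \<ge> 0 \<Longrightarrow> z t \<in> D"
  using assms unfolding strong_solution_def by blast+

lemma strong_solution_shift:
  assumes z: "strong_solution D F z0 z" and "c \<ge> 0"
  shows "strong_solution D F (z c) (\<lambda>t. z (c + t))"
  unfolding strong_solution_def
proof (intro conjI allI impI)
  fix b :: real assume "b \<ge> 0"
  then have "absolutely_continuous_on_interval 0 (b + c) z"
    using strong_solutionD(1)[OF z, of "b + c"] \<open>c \<ge> 0\<close> by simp
  then have "absolutely_continuous_on_interval (0 + c) (b + c) z"
    by (rule absolutely_continuous_on_subinterval) (use \<open>c \<ge> 0\<close> in auto)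
  then show "absolutely_continuous_on_interval 0 b (\<lambda>t. z (c + t))"
    by (rule absolutely_continuous_on_interval_shift)
next
  obtain N where N: "negligible N"
    "\<And>t. t \<ge> 0 \<Longrightarrow> t \<notin> N \<Longrightarrow> (z has_vector_derivative F (z t)) (at t within {0..})"
    using strong_solution_has_derivative[OF z] by metis
  have "(+) (- c) ` N \<in> null_sets lebesgue"
    using negligible_translation[OF N(1)] negligible_iff_null_sets by blast
  moreover have "((\<lambda>t. z (c + t)) has_vector_derivative F (z (c + t))) (at t within {0..})"
    if "t \<ge> 0" "t \<notin> (+) (- c) ` N" for t
  proof -
    have "c + t \<notin> N"
    proof
      assume "c + t \<in> N"
      then have "- c + (c + t) \<in> (+) (- c) ` N" by (rule imageI)
      then show False using that by simp
    qed
    then have "(z has_vector_derivative F (z (c + t))) (at (c + t) within (+) c ` {0..})"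
      using that \<open>c \<ge> 0\<close>
      by (intro has_vector_derivative_within_subset[OF N(2)[of "c + t"]]) auto
    moreover have "((+) c has_vector_derivative 1) (at t within {0..})"
      by (auto intro!: derivative_eq_intros)
    ultimately have "((z \<circ> (+) c) has_vector_derivative 1 *\<^sub>R F (z (c + t))) (at t within {0..})"
      by (intro vector_diff_chain_within)
    then show ?thesis by (simp add: o_def)
  qed
  ultimately have "AE t in lebesgue. t \<ge> 0 \<longrightarrow>
      ((\<lambda>t. z (c + t)) has_vector_derivative F (z (c + t))) (at t within {0..})"
    by (intro AE_I'[of "(+) (- c) ` N"]) auto
  then show "AE t in lborel. t \<ge> 0 \<longrightarrow>
      ((\<lambda>t. z (c + t)) has_vector_derivative F (z (c + t))) (at t within {0..})"
    by (simp add: AE_completion_iff)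
qed (use z \<open>c \<ge> 0\<close> in \<open>auto intro: strong_solutionD\<close>)

text \<open>Off the two exceptional sets, half the derivative of the squared distance is the
  dissipativity expression. The main use is to compare a solution with its own time shift.\<close>

lemma strong_solution_dist_nonincreasing:
  fixes F :: "'h::real_inner \<Rightarrow> 'h"
  assumes z1: "strong_solution D F x1 z1" and z2: "strong_solution D F x2 z2"
    and dissipative: "\<And>x y. x \<in> D \<Longrightarrow> y \<in> D \<Longrightarrow> (F x - F y) \<bullet> (x - y) \<le> 0"
    and "t \<ge> 0"
  shows "norm (z1 t - z2 t) \<le> norm (x1 - x2)"
proof -
  obtain N1 where N1: "negligible N1"
    "\<And>t. t \<ge> 0 \<Longrightarrow> t \<notin> N1 \<Longrightarrow> (z1 has_vector_derivative F (z1 t)) (at t within {0..})"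
    using strong_solution_has_derivative[OF z1] by metis
  obtain N2 where N2: "negligible N2"
    "\<And>t. t \<ge> 0 \<Longrightarrow> t \<notin> N2 \<Longrightarrow> (z2 has_vector_derivative F (z2 t)) (at t within {0..})"
    using strong_solution_has_derivative[OF z2] by metis
  have "absolutely_continuous_on_interval 0 t (\<lambda>t. z1 t + (-1) *\<^sub>R z2 t)"
    using \<open>t \<ge> 0\<close> by (intro absolutely_continuous_on_interval_linear_combination
      strong_solutionD(1)[OF z1] strong_solutionD(1)[OF z2])
  then have "absolutely_continuous_on_interval 0 t (\<lambda>t. (norm (z1 t - z2 t))\<^sup>2)"
    by (intro absolutely_continuous_on_interval_power2_norm) simp
  then have "(norm (z1 t - z2 t))\<^sup>2 \<le> (norm (z1 0 - z2 0))\<^sup>2"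
  proof (rule absolutely_continuous_nonpos_derivative_imp_le)
    show "negligible (N1 \<union> N2)" using N1 N2 by simp
    fix s assume s: "s \<in> {0..t} - (N1 \<union> N2)"
    have "((\<lambda>t. z1 t - z2 t) has_vector_derivative F (z1 s) - F (z2 s)) (at s within {0..t})"
      using s by (intro has_vector_derivative_diff
        has_vector_derivative_within_subset[OF N1(2)[of s]]
        has_vector_derivative_within_subset[OF N2(2)[of s]]) auto
    from has_vector_derivative_power2_norm[OF this]
    moreover have "2 * ((z1 s - z2 s) \<bullet> (F (z1 s) - F (z2 s))) \<le> 0"
      using dissipative[of "z1 s" "z2 s"] strong_solutionD(3)[OF z1, of s] strong_solutionD(3)[OF z2, of s] s
      by (simp add: inner_commute)
    ultimately show "\<exists>d\<le>0. ((\<lambda>t. (norm (z1 t - z2 t))\<^sup>2) has_real_derivative d) (at s within {0..t})"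
      by blast
  qed fact
  then show ?thesis
    unfolding strong_solutionD(2)[OF z1] strong_solutionD(2)[OF z2] by (rule power2_le_imp_le) simp
qed

text \<open>Dissipativity allows \<open>F (z t)\<close> to be replaced by \<open>F z0\<close> in the
  derivative of the squared displacement, so no bound on later speeds is required.\<close>

lemma strong_solution_initial_displacement:
  fixes F :: "'h::real_inner \<Rightarrow> 'h"
  assumes z: "strong_solution D F z0 z"
    and dissipative: "\<And>x y. x \<in> D \<Longrightarrow> y \<in> D \<Longrightarrow> (F x - F y) \<bullet> (x - y) \<le> 0"
    and "h \<ge> 0"
  shows "norm (z h - z0) \<le> 2 * norm (F z0) * h"
proof -
  note zD = strong_solutionD[OF z]
  have "z0 \<in> D" using zD(2) zD(3)[of 0] by simp
  obtain N where N: "negligible N"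
    "\<And>t. t \<ge> 0 \<Longrightarrow> t \<notin> N \<Longrightarrow> (z has_vector_derivative F (z t)) (at t within {0..})"
    using strong_solution_has_derivative[OF z] by metis
  have "continuous_on {0..h} (\<lambda>t. norm (z t - z0))"
    using absolutely_continuous_on_interval_imp_continuous_on[OF zD(1)[OF \<open>h \<ge> 0\<close>]]
    by (intro continuous_intros)
  \<comment> \<open>At a time \<open>s\<close> of maximal displacement \<open>m\<close>, the
    estimate reads m^2 <= 2 m |F z0| s and a factor \<open>m\<close> cancels. Using \<open>m\<close>
    at all earlier times is the origin of the factor 2.\<close>
  then obtain s where s: "s \<in> {0..h}" and max: "\<And>t. t \<in> {0..h} \<Longrightarrow> norm (z t - z0) \<le> norm (z s - z0)"
    using continuous_attains_sup[of "{0..h}" "\<lambda>t. norm (z t - z0)"] \<open>h \<ge> 0\<close> by auto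
  define m where "m = norm (z s - z0)"
  have "absolutely_continuous_on_interval 0 s (\<lambda>t. z t + (-1) *\<^sub>R z0)"
    using s by (intro absolutely_continuous_on_interval_linear_combination
      absolutely_continuous_on_interval_const zD) auto
  then have "absolutely_continuous_on_interval 0 s (\<lambda>t. (norm (z t - z0))\<^sup>2)"
    by (intro absolutely_continuous_on_interval_power2_norm) simp
  then have "absolutely_continuous_on_interval 0 s
      (\<lambda>t. (norm (z t - z0))\<^sup>2 + (- (2 * norm (F z0) * m)) *\<^sub>R t)"
    by (intro absolutely_continuous_on_interval_linear_combination absolutely_continuous_on_interval_ident)
  then have "(norm (z s - z0))\<^sup>2 + (- (2 * norm (F z0) * m)) *\<^sub>R s
      \<le> (norm (z 0 - z0))\<^sup>2 + (- (2 * norm (F z0) * m)) *\<^sub>R 0"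
  proof (rule absolutely_continuous_nonpos_derivative_imp_le)
    show "0 \<le> s" using s by simp
    fix t assume t: "t \<in> {0..s} - N"
    have "(z t - z0) \<bullet> F (z t) = (F (z t) - F z0) \<bullet> (z t - z0) + (z t - z0) \<bullet> F z0"
      by (simp add: inner_diff_left inner_diff_right inner_commute)
    also have "\<dots> \<le> (z t - z0) \<bullet> F z0"
      using dissipative[of "z t" z0] \<open>z0 \<in> D\<close> zD(3)[of t] t by simp
    also have "\<dots> \<le> norm (z t - z0) * norm (F z0)" by (rule norm_cauchy_schwarz)
    also have "\<dots> \<le> m * norm (F z0)"
      unfolding m_def using t s by (intro mult_right_mono max) auto
    finally have le: "(z t - z0) \<bullet> F (z t) \<le> m * norm (F z0)" .
    have "((\<lambda>t. z t - z0) has_vector_derivative F (z t) - 0) (at t within {0..s})"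
      using t by (intro has_vector_derivative_diff has_vector_derivative_const
          has_vector_derivative_within_subset[OF N(2)[of t]]) auto
    note sq = has_vector_derivative_power2_norm[OF this]
    have "((\<lambda>t. (norm (z t - z0))\<^sup>2 + (- (2 * norm (F z0) * m)) *\<^sub>R t) has_real_derivative
        2 * ((z t - z0) \<bullet> F (z t)) - 2 * norm (F z0) * m) (at t within {0..s})"
      unfolding real_scaleR_def by (rule DERIV_cong[OF DERIV_add[OF sq DERIV_cmult[OF DERIV_ident]]]) simp
    then show "\<exists>d\<le>0. ((\<lambda>t. (norm (z t - z0))\<^sup>2 + (- (2 * norm (F z0) * m)) *\<^sub>R t)
        has_real_derivative d) (at t within {0..s})"
      using le by (intro exI[of _ "2 * ((z t - z0) \<bullet> F (z t)) - 2 * norm (F z0) * m"])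
        (auto simp: mult.commute[of m])
  qed (fact N)
  then have "m * m \<le> (2 * norm (F z0) * s) * m"
    by (simp add: zD(2) m_def power2_eq_square mult_ac)
  then have "m \<le> 2 * norm (F z0) * s"
    using s by (cases "m = 0") (auto simp: m_def)
  also have "\<dots> \<le> 2 * norm (F z0) * h"
    using s by (intro mult_left_mono) auto
  finally show ?thesis using max[of h] \<open>h \<ge> 0\<close> unfolding m_def by simp
qed

text \<open>The increment from \<open>t\<close> to \<open>x\<close> is the distance at time
  \<open>t\<close> between the solution and its shift by \<open>x - t\<close>. That distance is at
  most the initial displacement over time \<open>x - t\<close>, which is linear in
  \<open>x - t\<close>.\<close>

lemma strong_solution_speed_bound:
  fixes F :: "'h::real_inner \<Rightarrow> 'h"
  assumes z: "strong_solution D F z0 z"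
    and dissipative: "\<And>x y. x \<in> D \<Longrightarrow> y \<in> D \<Longrightarrow> (F x - F y) \<bullet> (x - y) \<le> 0"
    and "t \<ge> 0" and deriv: "(z has_vector_derivative v) (at t within {0..})"
  shows "norm v \<le> 2 * norm (F z0)"
proof -
  have "(z has_vector_derivative v) (at_right t)"
    using deriv \<open>t \<ge> 0\<close> by (rule_tac has_vector_derivative_within_subset) auto
  then have "((\<lambda>x. norm ((z x - z t) /\<^sub>R (x - t))) \<longlongrightarrow> norm v) (at_right t)"
    unfolding has_vector_derivative_within_quotient by (rule tendsto_norm)
  moreover have "\<forall>\<^sub>F x in at_right t. norm ((z x - z t) /\<^sub>R (x - t)) \<le> 2 * norm (F z0)"
  proof (rule eventually_at_right_less[THEN eventually_mono])
    fix x assume "t < x"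
    have "norm (z (x - t + t) - z t) \<le> norm (z (x - t) - z0)"
      using strong_solution_dist_nonincreasing[OF strong_solution_shift[OF z, of "x - t"] z dissipative \<open>t \<ge> 0\<close>]
        \<open>t < x\<close> by simp
    also have "\<dots> \<le> 2 * norm (F z0) * (x - t)"
      using \<open>t < x\<close> by (intro strong_solution_initial_displacement[OF z dissipative]) auto
    finally show "norm ((z x - z t) /\<^sub>R (x - t)) \<le> 2 * norm (F z0)"
      using \<open>t < x\<close> by (simp add: divide_inverse_commute[symmetric] pos_divide_le_eq)
  qed
  ultimately show ?thesis
    by (rule tendsto_upperbound) simp
qed

text \<open>Multiply by \<open>1 + t\<close>, take the supremum over \<open>[0, T]\<close>, and restart the estimate at a
  time proportional to \<open>t\<close>, with ratio strictly between \<open>q\<close> and 1.\<close>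

lemma restarted_contraction_imp_decay:
  fixes E :: "real \<Rightarrow> real"
  assumes q: "0 \<le> q" "q < 1" and "K \<ge> 0" and N: "negligible N"
    and bounds: "\<And>t. t \<ge> 0 \<Longrightarrow> 0 \<le> E t \<and> E t \<le> E0"
    and restart: "\<And>t \<tau>. t \<ge> 0 \<Longrightarrow> t \<notin> N \<Longrightarrow> \<tau> \<ge> 0 \<Longrightarrow> E (t + \<tau>) \<le> q * E t + K / (1 + \<tau>)"
    and "T \<ge> 0"
  shows "(1 + T) * E T \<le> 9 * (K + E0) / (1 - q)\<^sup>2"
proof -
  \<comment> \<open>These lie one third and two thirds of the way from \<open>q\<close> to 1. The
    gap above \<open>q\<close> makes the factor q/\<nu> smaller than 1, the gap below 1 keeps the
    window long, and the gap between them leaves room to avoid \<open>N\<close>.\<close>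
  define \<nu> \<mu> where "\<nu> = (1 + 2 * q) / 3" and "\<mu> = (2 + q) / 3"
  have lm: "0 < \<nu>" "q < \<nu>" "\<nu> < \<mu>" "\<mu> < 1" unfolding \<nu>_def \<mu>_def using q by auto
  have "E0 \<ge> 0" using bounds[of 0] by simp
  define G where "G t = (1 + t) * E t" for t
  \<comment> \<open>The crude bound makes the supremum \<open>M\<close> finite, so that it can be
    absorbed at the end.\<close>
  have bdd: "bdd_above (G ` {0..T})"
  proof (rule bdd_aboveI2)
    fix t assume "t \<in> {0..T}"
    then show "G t \<le> (1 + T) * E0"
      unfolding G_def using bounds[of t] by (intro mult_mono) auto
  qed
  define M where "M = Sup (G ` {0..T})"
  have G_le: "G t \<le> M" if "t \<in> {0..T}" for t
    unfolding M_def using that bdd by (intro cSup_upper) auto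
  have "M \<ge> 0" using G_le[of 0] bounds[of 0] \<open>T \<ge> 0\<close> unfolding G_def by simp
  have "G t \<le> q / \<nu> * M + (K + E0) / (1 - \<mu>)" if t: "t \<in> {0..T}" for t
  proof (cases "t = 0")
    case True
    \<comment> \<open>At time 0 the interval of restart times degenerates and may lie in
      \<open>N\<close>; the a priori bound \<open>E0\<close> serves instead.\<close>
    have "G t \<le> E0" using True bounds[of 0] unfolding G_def by simp
    also have "\<dots> \<le> (K + E0) / (1 - \<mu>)"
      using lm \<open>K \<ge> 0\<close> \<open>E0 \<ge> 0\<close> by (simp add: pos_le_divide_eq algebra_simps)
    finally show ?thesis using lm q \<open>M \<ge> 0\<close> by (simp add: add_increasing)
  next
    case False
    then have "t > 0" using t by simp
    have "\<not> {\<nu> * t..\<mu> * t} \<subseteq> N"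
    proof
      assume "{\<nu> * t..\<mu> * t} \<subseteq> N"
      then have "negligible {\<nu> * t..\<mu> * t}" using N negligible_subset by blast
      then have "negligible (cbox (\<nu> * t) (\<mu> * t))" by simp
      then have "box (\<nu> * t) (\<mu> * t) = {}" using negligible_interval(1) by blast
      then show False using lm \<open>t > 0\<close> by (simp add: box_real)
    qed
    then obtain s where s: "\<nu> * t \<le> s" "s \<le> \<mu> * t" "s \<notin> N"
      by (meson atLeastAtMost_iff subsetI)
    have "\<mu> * t \<le> t" "0 \<le> \<nu> * t" using lm \<open>t > 0\<close> by auto
    then have s': "0 \<le> s" "s \<le> t" using s by auto
    have "E t \<le> q * E s + K / (1 + (t - s))"
      using restart[of s "t - s"] s s' by simp
    then have "G t \<le> (1 + t) * (q * E s + K / (1 + (t - s)))"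
      unfolding G_def using \<open>t > 0\<close> by (intro mult_left_mono) auto
    also have "\<dots> = q * ((1 + t) * E s) + K * ((1 + t) / (1 + (t - s)))"
      by (simp add: algebra_simps)
    also have "\<dots> \<le> q * (M / \<nu>) + K * (1 / (1 - \<mu>))"
    proof (intro add_mono mult_left_mono q \<open>K \<ge> 0\<close>)
      have "\<nu> * (1 + t) \<le> 1 + s" using s lm by (simp add: algebra_simps)
      then have "(\<nu> * (1 + t)) * E s \<le> (1 + s) * E s"
        using bounds[of s] s' by (intro mult_right_mono) auto
      also have "\<dots> \<le> M" using G_le[of s] s' t unfolding G_def by simp
      finally show "(1 + t) * E s \<le> M / \<nu>" using lm by (simp add: pos_le_divide_eq mult_ac)
      have "(1 - \<mu>) * (1 + t) \<le> 1 + (t - s)" using s lm by (simp add: algebra_simps)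
      then show "(1 + t) / (1 + (t - s)) \<le> 1 / (1 - \<mu>)"
        using lm s' by (simp add: divide_simps mult_ac)
    qed
    also have "\<dots> \<le> q / \<nu> * M + (K + E0) / (1 - \<mu>)"
      using lm \<open>E0 \<ge> 0\<close> by (simp add: divide_right_mono)
    finally show ?thesis .
  qed
  then have "M \<le> q / \<nu> * M + (K + E0) / (1 - \<mu>)"
    unfolding M_def using \<open>T \<ge> 0\<close> by (intro cSup_least) auto
  then have "(1 - q / \<nu>) * M \<le> (K + E0) / (1 - \<mu>)" by (simp add: algebra_simps)
  also have "(K + E0) / (1 - \<mu>) = 3 * (K + E0) / (1 - q)"
    unfolding \<mu>_def using q by (simp add: field_simps)
  finally have "(1 - q / \<nu>) * M \<le> 3 * (K + E0) / (1 - q)" .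
  \<comment> \<open>As q <= 1, this is at least (1 - q)/3; with 1 - \<mu> = (1 - q)/3 it produces
    the constant 9.\<close>
  moreover have "1 - q / \<nu> = (1 - q) / (1 + 2 * q)"
    unfolding \<nu>_def using q by (simp add: field_simps)
  moreover have "(1 - q) / 3 * M \<le> (1 - q) / (1 + 2 * q) * M"
    using q \<open>M \<ge> 0\<close> by (intro mult_right_mono divide_left_mono) auto
  ultimately have "(1 - q) / 3 * M \<le> 3 * (K + E0) / (1 - q)" by (metis order_trans)
  then have "M \<le> 9 * (K + E0) / (1 - q)\<^sup>2"
    using q by (simp add: pos_le_divide_eq power2_eq_square mult_ac)
  then show ?thesis using G_le[of T] \<open>T \<ge> 0\<close> unfolding G_def by simp
qed

section \<open>Damped systems\<close>

text \<open>The linear decay is recorded with exponent 1/2, the one transmitted to the nonlinear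
  system.\<close>

locale damped_system =
  fixes D :: "'h::{real_inner, complete_space} set"
    and A :: "'h \<Rightarrow> 'h"
    and B :: "'u::{real_inner, complete_space} \<Rightarrow> 'h"
    and S :: "real \<Rightarrow> 'h \<Rightarrow> 'h"
    and \<sigma> :: "'u \<Rightarrow> 'u"
    and k C0 :: real
  assumes dense_linear: "densely_defined_linear D A"
    and contraction_A: "generates_contraction_semigroup D A"
    and bounded_linear_B: "bounded_linear B"
    and k_pos: "k > 0"
    and generator_S: "generates_C0_semigroup D (linear_closed_loop A B k) S"
    and C0_pos: "C0 > 0"
    and decay: "\<And>x t. x \<in> D \<Longrightarrow> t \<ge> 0 \<Longrightarrow>
      norm (S t x) \<le> C0 / (1 + t) powr (1 / 2) * graph_norm (linear_closed_loop A B k) x"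
    and damping: "damping_function \<sigma>"
begin

abbreviation L where "L \<equiv> linear_closed_loop A B k"
abbreviation F where "F \<equiv> nonlinear_closed_loop A B k \<sigma>"

text \<open>Splitting \<open>k\<close> into two square roots makes \<open>obs\<close> the adjoint of
  the input operator \<open>sqrt k *\<^sub>R B\<close>, so both feedbacks become this operator
  applied to a function of \<open>obs x\<close>.\<close>

definition obs :: "'h \<Rightarrow> 'u" where "obs x = sqrt k *\<^sub>R adjoint B x"

lemma bounded_linear_obs: "bounded_linear obs"
  unfolding obs_def by (intro bounded_linear_scaleR_const bounded_linear_const_scaleR
      bounded_linear_adjoint bounded_linear_B)

lemma obs_diff: "obs (x - y) = obs x - obs y"
  using bounded_linear.linear[OF bounded_linear_obs] by (rule linear_diff)

lemma obs_bound: obtains b where "b \<ge> 0" "\<And>x. norm (obs x) \<le> norm x * b"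
  using bounded_linear.nonneg_bounded[OF bounded_linear_obs] by blast

lemma input_diff: "B (u - v) = B u - B v"
  using bounded_linear.linear[OF bounded_linear_B] by (rule linear_diff)

lemma input_inner: "(sqrt k *\<^sub>R B u) \<bullet> x = u \<bullet> obs x"
  unfolding obs_def by (simp add: adjoint_inner_right[OF bounded_linear_B])

lemma F_eq: "F x = A x - sqrt k *\<^sub>R B (\<sigma> (obs x))"
  unfolding nonlinear_closed_loop_def obs_def ..

lemma L_eq: "L x = A x - sqrt k *\<^sub>R B (obs x)"
proof -
  have "B (sqrt k *\<^sub>R adjoint B x) = sqrt k *\<^sub>R B (adjoint B x)"
    using bounded_linear.linear[OF bounded_linear_B] by (rule linear_scale)
  then show ?thesis
    unfolding linear_closed_loop_def obs_def using k_pos by (simp flip: power2_eq_square)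
qed

lemma F_eq_L: "F x = L x + sqrt k *\<^sub>R B (obs x - \<sigma> (obs x))"
  unfolding F_eq L_eq input_diff by (simp add: scaleR_diff_right)

lemma subspace_D: "subspace D" and closure_D: "closure D = UNIV"
  using dense_linear unfolding densely_defined_linear_def by auto

lemma A_diff: "x \<in> D \<Longrightarrow> y \<in> D \<Longrightarrow> A (x - y) = A x - A y"
proof -
  assume xy: "x \<in> D" "y \<in> D"
  then have "- y \<in> D" using subspace_D by (simp add: subspace_neg)
  have add: "\<forall>x\<in>D. \<forall>y\<in>D. A (x + y) = A x + A y" and scale: "\<forall>c. \<forall>x\<in>D. A (c *\<^sub>R x) = c *\<^sub>R A x"
    using dense_linear unfolding densely_defined_linear_def by auto
  have "A (x + - y) = A x + A (- y)" using add xy(1) \<open>- y \<in> D\<close> by blast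
  moreover have "A (- 1 *\<^sub>R y) = - 1 *\<^sub>R A y" using scale xy(2) by blast
  ultimately show "A (x - y) = A x - A y" by simp
qed

lemma L_diff: "x \<in> D \<Longrightarrow> y \<in> D \<Longrightarrow> L (x - y) = L x - L y"
  unfolding L_eq by (simp add: A_diff obs_diff input_diff scaleR_diff_right)

text \<open>The easy half of the Lumer-Phillips theorem: contraction and Cauchy-Schwarz make the
  difference quotients paired with \<open>x\<close> nonpositive.\<close>

lemma A_dissipative:
  assumes "x \<in> D"
  shows "A x \<bullet> x \<le> 0"
proof -
  obtain T where T: "generates_C0_semigroup D A T" and contr: "\<forall>t\<ge>0. \<forall>z. norm (T t z) \<le> norm z"
    using contraction_A unfolding generates_contraction_semigroup_def by auto
  have "((\<lambda>t. ((T t x - x) /\<^sub>R t) \<bullet> x) \<longlongrightarrow> A x \<bullet> x) (at_right 0)"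
    using generates_C0_semigroupD(5)[OF T assms] by (intro tendsto_intros)
  moreover have "\<forall>\<^sub>F t in at_right 0. ((T t x - x) /\<^sub>R t) \<bullet> x \<le> 0"
  proof (rule eventually_at_right_less[THEN eventually_mono])
    fix t :: real assume "0 < t"
    have "T t x \<bullet> x \<le> norm (T t x) * norm x" by (rule norm_cauchy_schwarz)
    also have "\<dots> \<le> norm x * norm x" using contr \<open>0 < t\<close> by (intro mult_right_mono) auto
    finally have "(T t x - x) \<bullet> x \<le> 0"
      by (simp add: inner_diff_left power2_norm_eq_inner[symmetric] power2_eq_square)
    then show "((T t x - x) /\<^sub>R t) \<bullet> x \<le> 0"
      using \<open>0 < t\<close> by (simp add: mult_nonneg_nonpos)
  qed
  ultimately show ?thesis by (rule tendsto_upperbound) simp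
qed

lemma L_dissipative: "x \<in> D \<Longrightarrow> L x \<bullet> x \<le> - (norm (obs x))\<^sup>2"
  using A_dissipative[of x] unfolding L_eq inner_diff_left input_inner by (simp add: power2_norm_eq_inner)

section \<open>Sector bounds for the damping function\<close>

lemma sigma_monotone: "(\<sigma> s1 - \<sigma> s2) \<bullet> (s1 - s2) \<ge> 0"
  using damping unfolding damping_function_def by blast

text \<open>At the origin the right side of (D3) is an inner product with 0.\<close>

lemma sigma_zero: "\<sigma> 0 = 0"
proof -
  obtain C1 C2 and h :: "real \<Rightarrow> real" where
    "\<forall>s. norm (\<sigma> s - C1 *\<^sub>R s) \<le> C2 * h (norm s) * (\<sigma> s \<bullet> s)"
    using damping unfolding damping_function_def by blast
  from spec[OF this, of 0] show ?thesis by simp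
qed

lemma sigma_inner_nonneg: "\<sigma> s \<bullet> s \<ge> 0"
  using sigma_monotone[of s 0] by (simp add: sigma_zero)

text \<open>On a ball the damping satisfies a sector condition, since \<open>C\<^sub>1 |s|\<^sup>2\<close> is at most
  \<open>\<langle>\<sigma> s, s\<rangle> + |\<sigma> s - C\<^sub>1 s| |s|\<close>.\<close>

lemma sigma_sector:
  obtains M where "M > 0"
    "\<And>s. norm s \<le> R \<Longrightarrow> (norm (s - \<sigma> s))\<^sup>2 \<le> M * (\<sigma> s \<bullet> s)"
    "\<And>s. norm s \<le> R \<Longrightarrow> norm (s - \<sigma> s) \<le> M * norm s"
    "\<And>s. norm s \<le> R \<Longrightarrow> norm (\<sigma> s) \<le> M * norm s"
proof -
  obtain C1 C2 and h :: "real \<Rightarrow> real" where C: "C1 > 0" "C2 > 0" and h: "mono h" "\<And>x. h x \<ge> 0"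
    and bound: "\<And>s. norm (\<sigma> s - C1 *\<^sub>R s) \<le> C2 * h (norm s) * (\<sigma> s \<bullet> s)"
    using damping unfolding damping_function_def by blast
  have "\<exists>l. l-lipschitz_on (cball 0 R) \<sigma>"
    using damping unfolding damping_function_def lipschitz_on_bounded_sets_def by blast
  then obtain l where l: "l-lipschitz_on (cball 0 R) \<sigma>" ..
  then have "l \<ge> 0" by (rule lipschitz_on_nonneg)
  have sigma_le: "norm (\<sigma> s) \<le> l * norm s" if "norm s \<le> R" for s
  proof -
    \<comment> \<open>\<open>R\<close> is arbitrary; a point in the ball shows that the ball also
      contains 0, where \<sigma> vanishes.\<close>
    have "0 \<le> R" using that norm_ge_zero order_trans by blast
    then show ?thesis using lipschitz_onD[OF l, of s 0] that by (simp add: sigma_zero)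
  qed
  have diff_le: "norm (s - \<sigma> s) \<le> (1 + l) * norm s" if "norm s \<le> R" for s
    using norm_triangle_ineq4[of s "\<sigma> s"] sigma_le[OF that] by (simp add: algebra_simps)
  define K where "K = (1 + C2 * h R * \<bar>R\<bar>) / C1"
  have "K \<ge> 0" unfolding K_def using C h(2)[of R] by simp
  have sq_le: "(norm s)\<^sup>2 \<le> K * (\<sigma> s \<bullet> s)" if "norm s \<le> R" for s
  proof -
    have "C1 * (norm s)\<^sup>2 = \<sigma> s \<bullet> s - (\<sigma> s - C1 *\<^sub>R s) \<bullet> s"
      by (simp add: inner_diff_left power2_norm_eq_inner)
    also have "\<dots> \<le> \<sigma> s \<bullet> s + norm (\<sigma> s - C1 *\<^sub>R s) * norm s"
      using Cauchy_Schwarz_ineq2[of "\<sigma> s - C1 *\<^sub>R s" s] by (simp add: abs_le_iff)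
    also have "norm (\<sigma> s - C1 *\<^sub>R s) * norm s \<le> (C2 * h R * (\<sigma> s \<bullet> s)) * \<bar>R\<bar>"
    proof (rule mult_mono)
      have "C2 * h (norm s) * (\<sigma> s \<bullet> s) \<le> C2 * h R * (\<sigma> s \<bullet> s)"
        using C monoD[OF h(1) that] by (intro mult_right_mono mult_left_mono sigma_inner_nonneg) auto
      with bound[of s] show "norm (\<sigma> s - C1 *\<^sub>R s) \<le> C2 * h R * (\<sigma> s \<bullet> s)" by simp
      show "0 \<le> C2 * h R * (\<sigma> s \<bullet> s)" using C h(2) sigma_inner_nonneg by simp
    qed (use that in auto)
    finally have "C1 * (norm s)\<^sup>2 \<le> (1 + C2 * h R * \<bar>R\<bar>) * (\<sigma> s \<bullet> s)" by (simp add: algebra_simps)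
    then show ?thesis unfolding K_def using C by (simp add: pos_le_divide_eq mult_ac)
  qed
  \<comment> \<open>The first summand serves the two linear bounds; the second combines the squared
    linear bound with \<open>sq_le\<close>.\<close>
  define M where "M = (1 + l) + (1 + l)\<^sup>2 * K"
  have M_ge: "M \<ge> 1 + l" "M \<ge> (1 + l)\<^sup>2 * K"
    unfolding M_def using \<open>K \<ge> 0\<close> \<open>l \<ge> 0\<close> by auto
  show thesis
  proof (rule that[of M])
    show "M > 0" using M_ge \<open>l \<ge> 0\<close> by simp
    fix s :: 'u assume s: "norm s \<le> R"
    have "(norm (s - \<sigma> s))\<^sup>2 \<le> ((1 + l) * norm s)\<^sup>2"
      using diff_le[OF s] by (intro power_mono) auto
    also have "\<dots> = (1 + l)\<^sup>2 * (norm s)\<^sup>2" by (simp add: power_mult_distrib)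
    also have "\<dots> \<le> (1 + l)\<^sup>2 * (K * (\<sigma> s \<bullet> s))" using sq_le[OF s] by (intro mult_left_mono) auto
    also have "\<dots> \<le> M * (\<sigma> s \<bullet> s)"
      using M_ge(2) sigma_inner_nonneg[of s] by (simp add: mult_right_mono flip: mult.assoc)
    finally show "(norm (s - \<sigma> s))\<^sup>2 \<le> M * (\<sigma> s \<bullet> s)" .
    have "(1 + l) * norm s \<le> M * norm s" using M_ge(1) by (intro mult_right_mono) auto
    with diff_le[OF s] show "norm (s - \<sigma> s) \<le> M * norm s" by simp
    have "l * norm s \<le> M * norm s" using M_ge(1) by (intro mult_right_mono) auto
    with sigma_le[OF s] show "norm (\<sigma> s) \<le> M * norm s" by simp
  qed
qed

section \<open>Dissipativity of the nonlinear operator\<close>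

lemma F_energy:
  assumes "x \<in> D"
  shows "x \<bullet> F x \<le> - (\<sigma> (obs x) \<bullet> obs x)"
proof -
  have "F x \<bullet> x = A x \<bullet> x - \<sigma> (obs x) \<bullet> obs x"
    unfolding F_eq inner_diff_left input_inner ..
  then show ?thesis
    using A_dissipative[OF assms] by (simp add: inner_commute)
qed

lemma F_dissipative:
  assumes "x \<in> D" "y \<in> D"
  shows "(F x - F y) \<bullet> (x - y) \<le> 0"
proof -
  have "F x - F y = A (x - y) - sqrt k *\<^sub>R B (\<sigma> (obs x) - \<sigma> (obs y))"
    unfolding F_eq A_diff[OF assms] input_diff by (simp add: algebra_simps)
  then have "(F x - F y) \<bullet> (x - y) = A (x - y) \<bullet> (x - y) - (\<sigma> (obs x) - \<sigma> (obs y)) \<bullet> (obs x - obs y)"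
    by (simp only: inner_diff_left[of "A (x - y)"] input_inner obs_diff)
  then show ?thesis
    using A_dissipative[of "x - y"] subspace_diff[OF subspace_D assms] sigma_monotone[of "obs x" "obs y"] by simp
qed

section \<open>Contraction and regularity of the linear semigroup\<close>

lemma S_bound: "t \<ge> 0 \<Longrightarrow> x \<in> D \<Longrightarrow> norm (S t x) \<le> C0 * graph_norm L x"
proof -
  assume "t \<ge> 0" "x \<in> D"
  have "C0 / (1 + t) powr (1 / 2) \<le> C0"
    using C0_pos \<open>t \<ge> 0\<close> ge_one_powr_ge_zero[of "1 + t" "1/2"] by (simp add: divide_le_eq mult_le_cancel_left1)
  then have "C0 / (1 + t) powr (1 / 2) * graph_norm L x \<le> C0 * graph_norm L x"
    by (intro mult_right_mono) (auto simp: graph_norm_def)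
  with decay[OF \<open>x \<in> D\<close> \<open>t \<ge> 0\<close>] show ?thesis by simp
qed

lemma S_continuous: "x \<in> D \<Longrightarrow> continuous_on {0..} (\<lambda>t. S t x)"
  by (rule semigroup_orbit_continuous[OF generator_S subspace_D _ L_diff S_bound])

text \<open>The energy argument works for initial data in \<open>D\<close>; each \<open>S t\<close>
  is continuous, so density extends the inequality.\<close>

lemma S_contraction: "t \<ge> 0 \<Longrightarrow> norm (S t x) \<le> norm x"
proof (rule contraction_on_dense_subset[OF generates_C0_semigroupD(2)[OF generator_S] closure_D])
  fix x assume "t \<ge> 0" "x \<in> D"
  then show "norm (S t x) \<le> norm x"
  proof (rule_tac semigroup_contraction_on_domain[OF generator_S _ _ _ S_continuous])
    show "L x \<bullet> x \<le> 0" if "x \<in> D" for x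
      using L_dissipative[OF that] by (smt (verit) zero_le_power2)
  qed
qed

text \<open>Orbits starting in \<open>D\<close> are Lipschitz, so the identity dominates their
  increments.\<close>

lemma S_absolutely_continuous:
  assumes "x \<in> D"
  shows "absolutely_continuous_on_interval 0 b (\<lambda>t. S t x)"
proof (rule absolutely_continuous_on_interval_comparison
    [OF absolutely_continuous_on_interval_ident absolutely_continuous_on_interval_ident])
  note lip = contraction_semigroup_orbit_Lipschitz[OF generator_S assms _ _ S_contraction S_continuous[OF assms]]
  fix s t assume st: "s \<in> {0..b}" "t \<in> {0..b}"
  have "dist (S s x) (S t x) \<le> norm (L x) * \<bar>s - t\<bar>"
    using lip[of s t] lip[of t s] st by (cases "s \<le> t") (auto simp: dist_norm norm_minus_commute)
  also have "\<dots> \<le> norm (L x) * (dist s t + dist s t)"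
    by (intro mult_left_mono) (auto simp: dist_real_def)
  finally show "dist (S s x) (S t x) \<le> norm (L x) * (dist s t + dist s t)" .
qed

section \<open>Energy estimates along nonlinear solutions\<close>

lemma solution_norm_le:
  assumes z: "strong_solution D F z0 z" and "t \<ge> 0"
  shows "norm (z t) \<le> norm z0"
proof -
  obtain N where N: "negligible N"
    "\<And>t. t \<ge> 0 \<Longrightarrow> t \<notin> N \<Longrightarrow> (z has_vector_derivative F (z t)) (at t within {0..})"
    using strong_solution_has_derivative[OF z] by metis
  have "(norm (z t))\<^sup>2 \<le> (norm (z 0))\<^sup>2"
  proof (rule absolutely_continuous_nonpos_derivative_imp_le[where f = "\<lambda>t. (norm (z t))\<^sup>2"])
    show "absolutely_continuous_on_interval 0 t (\<lambda>t. (norm (z t))\<^sup>2)"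
      using \<open>t \<ge> 0\<close> by (intro absolutely_continuous_on_interval_power2_norm strong_solutionD(1)[OF z])
    fix s assume s: "s \<in> {0..t} - N"
    have "(z has_vector_derivative F (z s)) (at s within {0..t})"
      using s by (intro has_vector_derivative_within_subset[OF N(2)[of s]]) auto
    moreover have "2 * (z s \<bullet> F (z s)) \<le> 0"
      using F_energy[OF strong_solutionD(3)[OF z]] sigma_inner_nonneg[of "obs (z s)"] s by fastforce
    ultimately show "\<exists>d\<le>0. ((\<lambda>t. (norm (z t))\<^sup>2) has_real_derivative d) (at s within {0..t})"
      using has_vector_derivative_power2_norm by blast
  qed (use N \<open>t \<ge> 0\<close> in auto)
  then show ?thesis
    unfolding strong_solutionD(2)[OF z] by (rule power2_le_imp_le) simp
qed

text \<open>The feedback mismatch \<open>s - \<sigma> s\<close> is square integrable along solutions, controlled by the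
  dissipated energy; the damped linear dynamics turns it into a bounded state perturbation.\<close>

lemma solution_close_to_linear_orbit:
  assumes z: "strong_solution D F z0 z" and "\<tau> \<ge> 0"
    and sector: "\<And>t. t \<ge> 0 \<Longrightarrow>
      (norm (obs (z t) - \<sigma> (obs (z t))))\<^sup>2 \<le> 4 * c * (\<sigma> (obs (z t)) \<bullet> obs (z t))"
    and "c \<ge> 0"
  shows "(norm (z \<tau> - S \<tau> z0))\<^sup>2 \<le> c * ((norm z0)\<^sup>2 - (norm (z \<tau>))\<^sup>2)"
proof -
  note zD = strong_solutionD[OF z]
  have "z0 \<in> D" using zD(2) zD(3)[of 0] by simp
  define y where "y t = z t - S t z0" for t
  obtain N where N: "negligible N"
    "\<And>t. t \<ge> 0 \<Longrightarrow> t \<notin> N \<Longrightarrow> (z has_vector_derivative F (z t)) (at t within {0..})"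
    using strong_solution_has_derivative[OF z] by metis
  \<comment> \<open>A Lyapunov function: the energy of the difference \<open>y\<close> may grow, but
    \<open>c\<close> times the energy of \<open>z\<close> falls at least as fast. At time 0 the
    difference vanishes.\<close>
  have "(norm (y \<tau>))\<^sup>2 + c *\<^sub>R (norm (z \<tau>))\<^sup>2 \<le> (norm (y 0))\<^sup>2 + c *\<^sub>R (norm (z 0))\<^sup>2"
  proof (rule absolutely_continuous_nonpos_derivative_imp_le
      [where f = "\<lambda>t. (norm (y t))\<^sup>2 + c *\<^sub>R (norm (z t))\<^sup>2" and N = "insert 0 N"])
    have "absolutely_continuous_on_interval 0 \<tau> (\<lambda>t. z t + (- 1) *\<^sub>R S t z0)"
      using \<open>\<tau> \<ge> 0\<close> \<open>z0 \<in> D\<close> by (intro absolutely_continuous_on_interval_linear_combination zD S_absolutely_continuous)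
    then have "absolutely_continuous_on_interval 0 \<tau> (\<lambda>t. (norm (y t))\<^sup>2)"
      unfolding y_def by (intro absolutely_continuous_on_interval_power2_norm) simp
    then show "absolutely_continuous_on_interval 0 \<tau> (\<lambda>t. (norm (y t))\<^sup>2 + c *\<^sub>R (norm (z t))\<^sup>2)"
      using \<open>\<tau> \<ge> 0\<close> by (rule absolutely_continuous_on_interval_linear_combination
        [OF _ absolutely_continuous_on_interval_power2_norm[OF zD(1)]])
    \<comment> \<open>Time 0 is excluded because the two-sided derivative of the linear orbit is
      known only for positive times.\<close>
    show "negligible (insert 0 N)" using N(1) by simp
    fix t assume t: "t \<in> {0..\<tau>} - insert 0 N"
    then have "t > 0" by auto
    have St: "S t z0 \<in> D" using generator_in_domain(1)[OF generator_S \<open>z0 \<in> D\<close>] \<open>t > 0\<close> by simp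
    have zt: "z t \<in> D" using zD(3) \<open>t > 0\<close> by simp
    define s g where "s = obs (z t)" and "g = obs (z t) - \<sigma> (obs (z t))"
    have dz: "(z has_vector_derivative F (z t)) (at t within {0..\<tau>})"
      using t by (intro has_vector_derivative_within_subset[OF N(2)[of t]]) auto
    have "((\<lambda>t. S t z0) has_vector_derivative L (S t z0)) (at t within {0..\<tau>})"
      by (rule has_vector_derivative_at_within
        [OF contraction_semigroup_has_derivative[OF generator_S \<open>z0 \<in> D\<close> \<open>t > 0\<close> S_contraction]])
    from has_vector_derivative_diff[OF dz this]
    have dy: "(y has_vector_derivative F (z t) - L (S t z0)) (at t within {0..\<tau>})"
      unfolding y_def .
    have "F (z t) - L (S t z0) = L (y t) + sqrt k *\<^sub>R B g"
      unfolding F_eq_L g_def y_def L_diff[OF zt St] by simp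
    then have "y t \<bullet> (F (z t) - L (S t z0)) = L (y t) \<bullet> y t + g \<bullet> obs (y t)"
      by (simp only: inner_add_right input_inner[symmetric] inner_commute[of "y t"])
    also have "\<dots> \<le> - (norm (obs (y t)))\<^sup>2 + g \<bullet> obs (y t)"
      using L_dissipative[of "y t"] subspace_diff[OF subspace_D zt St] unfolding y_def by simp
    \<comment> \<open>Completing the square lets the damping of \<open>L\<close> absorb the forcing
      by \<open>g\<close>. The quarter is matched by the factor 4 in the hypothesis
      \<open>sector\<close>.\<close>
    also have "\<dots> \<le> (norm g)\<^sup>2 / 4"
    proof -
      have "0 \<le> (obs (y t) - (1/2) *\<^sub>R g) \<bullet> (obs (y t) - (1/2) *\<^sub>R g)" by simp
      then show ?thesis
        by (simp add: power2_norm_eq_inner inner_diff inner_commute algebra_simps)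
    qed
    also have "\<dots> \<le> c * (\<sigma> s \<bullet> s)"
      using sector[of t] \<open>t > 0\<close> unfolding g_def s_def by simp
    finally have y_le: "y t \<bullet> (F (z t) - L (S t z0)) \<le> c * (\<sigma> s \<bullet> s)" .
    have "c * (z t \<bullet> F (z t)) \<le> c * (- (\<sigma> s \<bullet> s))"
      using F_energy[OF zt] \<open>c \<ge> 0\<close> unfolding s_def by (rule mult_left_mono)
    with y_le have "2 * (y t \<bullet> (F (z t) - L (S t z0))) + c * (2 * (z t \<bullet> F (z t))) \<le> 0" by simp
    moreover have "((\<lambda>t. (norm (y t))\<^sup>2 + c *\<^sub>R (norm (z t))\<^sup>2) has_real_derivative
        2 * (y t \<bullet> (F (z t) - L (S t z0))) + c * (2 * (z t \<bullet> F (z t)))) (at t within {0..\<tau>})"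
      unfolding real_scaleR_def
      by (intro DERIV_add DERIV_cmult has_vector_derivative_power2_norm dy dz)
    ultimately show "\<exists>d\<le>0. ((\<lambda>t. (norm (y t))\<^sup>2 + c *\<^sub>R (norm (z t))\<^sup>2)
        has_real_derivative d) (at t within {0..\<tau>})" by blast
  qed fact
  then show ?thesis
    using generates_C0_semigroupD(1)[OF generator_S, of z0]
    by (simp add: y_def zD(2) algebra_simps)
qed

theorem semiglobal_decay:
  assumes "r > 0"
  obtains C where "C > 0"
    "\<And>z0 z t. z0 \<in> D \<Longrightarrow> graph_norm A z0 \<le> r \<Longrightarrow> strong_solution D F z0 z \<Longrightarrow> t \<ge> 0 \<Longrightarrow>
      norm (z t) \<le> C / (1 + t) powr (1 / 2) * graph_norm A z0"
proof -
  obtain b where b: "b \<ge> 0" "\<And>x. norm (obs x) \<le> norm x * b"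
    using obs_bound by metis
  obtain M where "M > 0" and M:
    "\<And>s. norm s \<le> r * b \<Longrightarrow> (norm (s - \<sigma> s))\<^sup>2 \<le> M * (\<sigma> s \<bullet> s)"
    "\<And>s. norm s \<le> r * b \<Longrightarrow> norm (s - \<sigma> s) \<le> M * norm s"
    "\<And>s. norm s \<le> r * b \<Longrightarrow> norm (\<sigma> s) \<le> M * norm s"
    using sigma_sector[of "r * b"] by metis
  obtain \<beta> where \<beta>: "\<beta> \<ge> 0" "\<And>u. norm (B u) \<le> norm u * \<beta>"
    using bounded_linear.nonneg_bounded[OF bounded_linear_B] by blast
  define c where "c = M / 4"
  have "c > 0" unfolding c_def using \<open>M > 0\<close> by simp
  \<comment> \<open>Comes from e' <= 2c(e - e') + ... by moving 2c e' to the left and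
    dividing.\<close>
  define q where "q = 2 * c / (1 + 2 * c)"
  have q: "0 \<le> q" "q < 1" unfolding q_def using \<open>c > 0\<close> by (auto simp: divide_simps)
  \<comment> \<open>Bounds the input operator applied to either the damping or the mismatch,
    relative to the norm of the state.\<close>
  define P where "P = sqrt k * (M * b * \<beta>)"
  have "P \<ge> 0" unfolding P_def using k_pos \<open>M > 0\<close> b(1) \<beta>(1) by simp
  \<comment> \<open>Graph norm budget in units of \<open>G\<close>: 1 for the state, 2(1 + P) for
    the speed, and P for passing from \<open>F\<close> to \<open>L\<close>.\<close>
  define Q where "Q = 3 + 3 * P"
  \<comment> \<open>The 2 comes from splitting the state into the linear orbit and the deviation
    from it.\<close>
  define K where "K = 2 * C0\<^sup>2 * Q\<^sup>2"
  have "K \<ge> 0" unfolding K_def by simp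
  define C where "C = sqrt (9 * (K + 1) / (1 - q)\<^sup>2)"
  have C_pos: "9 * (K + 1) / (1 - q)\<^sup>2 > 0" using \<open>K \<ge> 0\<close> q by simp
  have input_le: "norm (sqrt k *\<^sub>R B u) \<le> P * norm x"
    if "norm u \<le> M * norm (obs x)" for u x
  proof -
    have "norm u \<le> M * (norm x * b)"
      using that b(2)[of x] \<open>M > 0\<close> by (meson mult_left_mono less_imp_le order_trans)
    then have "norm (B u) \<le> M * (norm x * b) * \<beta>"
      using \<beta> by (meson mult_right_mono order_trans)
    then have "sqrt k * norm (B u) \<le> sqrt k * (M * (norm x * b) * \<beta>)"
      using k_pos by (intro mult_left_mono) auto
    then show ?thesis using k_pos by (simp add: P_def mult_ac)
  qed
  show thesis
  proof (rule that[of C])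
    show "C > 0" unfolding C_def using C_pos by simp
    fix z0 z and t :: real
    assume "z0 \<in> D" and small: "graph_norm A z0 \<le> r" and z: "strong_solution D F z0 z" and "t \<ge> 0"
    define G where "G = graph_norm A z0"
    have G: "norm z0 \<le> G" "norm (A z0) + norm z0 = G" "G \<ge> 0" unfolding G_def graph_norm_def by auto
    note zD = strong_solutionD[OF z]
    have z_le: "norm (z t) \<le> norm z0" if "t \<ge> 0" for t using solution_norm_le[OF z that] .
    have obs_le: "norm (obs (z t)) \<le> r * b" if "t \<ge> 0" for t
    proof -
      have "norm (z t) \<le> r" using z_le[OF that] G small unfolding G_def by simp
      then have "norm (z t) * b \<le> r * b" using b(1) by (rule mult_right_mono)
      with b(2)[of "z t"] show ?thesis by simp
    qed
    obtain N where N: "negligible N"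
      "\<And>t. t \<ge> 0 \<Longrightarrow> t \<notin> N \<Longrightarrow> (z has_vector_derivative F (z t)) (at t within {0..})"
      using strong_solution_has_derivative[OF z] by metis
    have "norm (F z0) \<le> norm (A z0) + P * norm z0"
      using norm_triangle_ineq4[of "A z0" "sqrt k *\<^sub>R B (\<sigma> (obs z0))"]
        input_le[OF M(3)[of "obs z0"]] obs_le[of 0] zD(2) unfolding F_eq by simp
    also have "\<dots> \<le> G + P * G"
      using G \<open>P \<ge> 0\<close> norm_ge_zero[of z0] by (intro add_mono mult_left_mono) linarith+
    finally have F_z0: "norm (F z0) \<le> G + P * G" .
    have graph_le: "graph_norm L (z t) \<le> Q * G" if t: "t \<ge> 0" "t \<notin> N" for t
    proof -
      have "norm (F (z t)) \<le> 2 * norm (F z0)"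
        by (rule strong_solution_speed_bound[OF z F_dissipative t(1) N(2)[OF t]])
      moreover have "norm (L (z t)) \<le> norm (F (z t)) + P * norm (z t)"
      proof -
        have "norm (L (z t)) \<le> norm (F (z t)) + norm (sqrt k *\<^sub>R B (obs (z t) - \<sigma> (obs (z t))))"
          using norm_triangle_ineq4[of "F (z t)" "sqrt k *\<^sub>R B (obs (z t) - \<sigma> (obs (z t)))"]
          by (simp add: F_eq_L[of "z t"])
        also have "norm (sqrt k *\<^sub>R B (obs (z t) - \<sigma> (obs (z t)))) \<le> P * norm (z t)"
          by (rule input_le[OF M(2)[OF obs_le[OF t(1)]]])
        finally show ?thesis by simp
      qed
      moreover have "norm (z t) \<le> G" using z_le[OF t(1)] G by simp
      moreover from this have "P * norm (z t) \<le> P * G" using \<open>P \<ge> 0\<close> by (rule mult_left_mono)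
      ultimately show ?thesis
        using F_z0 unfolding graph_norm_def Q_def by (simp add: algebra_simps)
    qed
    \<comment> \<open>Both the source term and the a priori bound are multiples of G^2, which keeps
      the final estimate linear in \<open>G\<close>.\<close>
    have "(1 + t) * (norm (z t))\<^sup>2 \<le> 9 * (K * G\<^sup>2 + G\<^sup>2) / (1 - q)\<^sup>2"
    proof (rule restarted_contraction_imp_decay[OF q _ N(1) _ _ \<open>t \<ge> 0\<close>])
      show "K * G\<^sup>2 \<ge> 0" using \<open>K \<ge> 0\<close> by simp
      show "0 \<le> (norm (z t))\<^sup>2 \<and> (norm (z t))\<^sup>2 \<le> G\<^sup>2" if "t \<ge> 0" for t
        using z_le[OF that] G by (auto intro: power_mono)
    next
      fix t \<tau> :: real assume t: "t \<ge> 0" "t \<notin> N" and "\<tau> \<ge> 0"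
      define e e' w where "e = (norm (z t))\<^sup>2" and "e' = (norm (z (t + \<tau>)))\<^sup>2" and "w = S \<tau> (z t)"
      have "(norm (z (t + \<tau>) - S \<tau> (z t)))\<^sup>2 \<le> c * ((norm (z t))\<^sup>2 - (norm (z (t + \<tau>)))\<^sup>2)"
      proof (rule solution_close_to_linear_orbit[OF strong_solution_shift[OF z t(1)] \<open>\<tau> \<ge> 0\<close> _ less_imp_le[OF \<open>c > 0\<close>]])
        show "(norm (obs (z (t + u)) - \<sigma> (obs (z (t + u)))))\<^sup>2
            \<le> 4 * c * (\<sigma> (obs (z (t + u))) \<bullet> obs (z (t + u)))" if "u \<ge> 0" for u
          using M(1)[OF obs_le[of "t + u"]] t that unfolding c_def by simp
      qed
      then have close: "(norm (z (t + \<tau>) - w))\<^sup>2 \<le> c * (e - e')" unfolding e_def e'_def w_def .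
      have "norm w \<le> C0 / (1 + \<tau>) powr (1 / 2) * graph_norm L (z t)"
        unfolding w_def by (rule decay[OF zD(3)[OF t(1)] \<open>\<tau> \<ge> 0\<close>])
      also have "\<dots> \<le> C0 / (1 + \<tau>) powr (1 / 2) * (Q * G)"
        using graph_le[OF t] C0_pos by (intro mult_left_mono) auto
      finally have "(norm w)\<^sup>2 \<le> (C0 / (1 + \<tau>) powr (1 / 2) * (Q * G))\<^sup>2"
        by (intro power_mono) auto
      also have "\<dots> = C0\<^sup>2 * Q\<^sup>2 * G\<^sup>2 / (1 + \<tau>)"
        using \<open>\<tau> \<ge> 0\<close> by (simp add: power_mult_distrib power_divide powr_half_sqrt)
      finally have w_le: "2 * (norm w)\<^sup>2 \<le> K * G\<^sup>2 / (1 + \<tau>)" unfolding K_def by simp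
      \<comment> \<open>Parallelogram law for the deviation and \<open>w\<close>, with the square of
        their difference dropped.\<close>
      have "e' \<le> 2 * (norm (z (t + \<tau>) - w))\<^sup>2 + 2 * (norm w)\<^sup>2"
      proof -
        have "0 \<le> (norm ((z (t + \<tau>) - w) - w))\<^sup>2" by simp
        then show ?thesis unfolding e'_def
          by (simp add: power2_norm_eq_inner inner_diff inner_commute algebra_simps)
      qed
      with close w_le have "e' * (1 + 2 * c) \<le> 2 * c * e + K * G\<^sup>2 / (1 + \<tau>)"
        by (simp add: algebra_simps)
      then have "e' \<le> (2 * c * e + K * G\<^sup>2 / (1 + \<tau>)) / (1 + 2 * c)"
        using \<open>c > 0\<close> by (simp add: pos_le_divide_eq)
      also have "\<dots> = q * e + K * G\<^sup>2 / (1 + \<tau>) / (1 + 2 * c)"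
        unfolding q_def by (simp add: add_divide_distrib)
      also have "K * G\<^sup>2 / (1 + \<tau>) / (1 + 2 * c) \<le> K * G\<^sup>2 / (1 + \<tau>)"
        using divide_left_mono[of 1 "1 + 2 * c" "K * G\<^sup>2 / (1 + \<tau>)"] \<open>c > 0\<close> \<open>K \<ge> 0\<close> \<open>\<tau> \<ge> 0\<close>
        by simp
      finally show "(norm (z (t + \<tau>)))\<^sup>2 \<le> q * (norm (z t))\<^sup>2 + K * G\<^sup>2 / (1 + \<tau>)"
        unfolding e_def e'_def by simp
    qed
    also have "\<dots> = (C * G)\<^sup>2"
      using C_pos by (simp add: C_def power_mult_distrib algebra_simps)
    finally have "(norm (z t))\<^sup>2 \<le> (C * G)\<^sup>2 / (1 + t)"
      using \<open>t \<ge> 0\<close> by (simp add: pos_le_divide_eq mult_ac)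
    also have "\<dots> = (C / (1 + t) powr (1 / 2) * G)\<^sup>2"
      using \<open>t \<ge> 0\<close> by (simp add: power_mult_distrib power_divide powr_half_sqrt)
    finally show "norm (z t) \<le> C / (1 + t) powr (1 / 2) * graph_norm A z0"
      unfolding G_def[symmetric] by (rule power2_le_imp_le) (use \<open>C > 0\<close> G(3) in simp)
  qed
qed

end

theorem theorem3:
  fixes D :: "'h::{real_inner, complete_space} set"
    and A :: "'h \<Rightarrow> 'h"
    and B :: "'u::{real_inner, complete_space} \<Rightarrow> 'h"
    and S :: "real \<Rightarrow> 'h \<Rightarrow> 'h"
    and \<sigma> :: "'u \<Rightarrow> 'u"
    and k \<gamma>0 :: real
  assumes "densely_defined_linear D A"
    and "generates_contraction_semigroup D A"
    and "bounded_linear B"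
    and "k > 0"
    and "generates_C0_semigroup D (linear_closed_loop A B k) S"
    and "\<gamma>0 > 1 / 2"
    and "\<exists>C0>0. \<forall>z0\<in>D. \<forall>t\<ge>0.
           norm (S t z0) \<le> C0 / (1 + t) powr \<gamma>0 * graph_norm (linear_closed_loop A B k) z0"
    and "damping_function \<sigma>"
  shows "\<forall>r>0. \<exists>C>0. \<forall>z0\<in>D. graph_norm A z0 \<le> r \<longrightarrow>
           (\<forall>z. strong_solution D (nonlinear_closed_loop A B k \<sigma>) z0 z \<longrightarrow>
             (\<forall>t\<ge>0. norm (z t) \<le> C / (1 + t) powr (1 / 2) * graph_norm A z0))"
proof -
  obtain C0 where "C0 > 0" and decay: "\<And>z0 t. z0 \<in> D \<Longrightarrow> t \<ge> 0 \<Longrightarrow>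
      norm (S t z0) \<le> C0 / (1 + t) powr \<gamma>0 * graph_norm (linear_closed_loop A B k) z0"
    using assms(7) by blast
  interpret damped_system D A B S \<sigma> k C0
  proof (rule damped_system.intro)
    fix x and t :: real assume "x \<in> D" "t \<ge> 0"
    \<comment> \<open>Since 1 + t >= 1, lowering the exponent to 1/2 weakens the decay
      bound.\<close>
    have "C0 / (1 + t) powr \<gamma>0 \<le> C0 / (1 + t) powr (1 / 2)"
      using \<open>C0 > 0\<close> \<open>t \<ge> 0\<close> \<open>\<gamma>0 > 1 / 2\<close> by (intro divide_left_mono powr_mono) auto
    then have "C0 / (1 + t) powr \<gamma>0 * graph_norm (linear_closed_loop A B k) x
        \<le> C0 / (1 + t) powr (1 / 2) * graph_norm (linear_closed_loop A B k) x"
      by (rule mult_right_mono) (simp add: graph_norm_def)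
    with decay[OF \<open>x \<in> D\<close> \<open>t \<ge> 0\<close>]
    show "norm (S t x) \<le> C0 / (1 + t) powr (1 / 2) * graph_norm (linear_closed_loop A B k) x"
      by simp
  qed (rule assms \<open>C0 > 0\<close>)+
  show ?thesis
    using semiglobal_decay by metis
qed

end
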